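(* Let $(M,d,\ell)$ be a globally hyperbolic metric spacetime. Then $(M,d,\ell)$ is a Lorentzian length space if and only if (i) it is timelike curve-connected, (ii) it is an $M^2_\ll$-geodesic space, (iii) $I^\pm(x)$ is non-empty for all $x\in M$, (iv) $\ell^{-1}(\infty)$ is open, and (v) $\ell_-:=\max\{-\ell,0\}$ is continuous and real-valued on $M^2$.
   Context: A metric spacetime $(M,d,\ell)$ is a metric space $(M,d)$ (with its metric topology) with a time-separation function, i.e. a function $\ell:M^2\to[-\infty,0]\cup\{\infty\}$ with $\ell(x,x)\le0$ for all $x$ and $\ell(x,z)\le\ell(x,y)+\ell(y,z)$ whenever $\max\{\ell(x,y),\ell(y,z)\}<\infty$. Write $x\le y$ if $\ell(x,y)\le0$, $x<y$ if $x\le y$ and $x\neq y$, and $x\ll y$ if $\ell(x,y)<0$; $M^2_\le=\{\ell\le0\}$, $M^2_\ll=\{\ell<0\}$; $I^+(x)=\{y:x\ll y\}$, $I^-(x)=\{y:y\ll x\}$; $J(x,y)=\{z:x\le z\le y\}$. A path $\sigma:A\to M$ on an interval $A\subset\mathbb R$ is causal if $\ell(\sigma(s),\sigma(t))\le0$ for all $s<t$ in $A$, timelike if the inequality is always strict. A causal curve is a nonconstant causal path that is locally Lipschitz with respect to $d$; a timelike curve is a causal curve that is a timelike path. For a causal path $\sigma:[a,b]\to M$, $L_\ell(\sigma):=\sup\{\sum_{i=1}^N\ell(\sigma(s_{i-1}),\sigma(s_i)): N\in\mathbb N,\ a=s_0<\dots<s_N=b\}$; $L_d$ is defined by the same formula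 with $d$ in place of $\ell$. An $\ell$-curve is a causal curve $\sigma:[0,1]\to M$ with $L_\ell(\sigma)=\ell(\sigma(0),\sigma(1))$. Globally hyperbolic means: for each compact subset there is a uniform bound on the $d$-lengths of the causal curves it contains (non-totally imprisoning), and each $J(x,y)$ is compact. Timelike curve-connected: $x\ll y$ implies there is a timelike curve from $x$ to $y$. Causally curve-connected: $x\le y$, $x\ne y$ implies there is a causal curve from $x$ to $y$. An $M^2_\ll$-geodesic space is a metric spacetime in which each $(x,y)\in M^2_\ll$ is linked by an $\ell$-curve from $x$ to $y$. A Lorentzian prelength space is a metric spacetime in which $\ell_-$ is lower semicontinuous. Locally causally closed: each $(x,x)\in M^2$ admits a neighbourhood $U\times U$ in which $M^2_\le$ is closed. Localizable: each $x\in M$ has an open neighbourhood $\Omega_x$ such that (a) there is $C>0$ with $L_d(\sigma)\le C$ for all causal curves $\sigma$ contained in $\Omega_x$; (b) there is a continuous $\omega_x:\Omega_x\times\Omega_x\to[0,\infty)$ such that, with the restrictions of $d,\le,\ll$ to $\Omega_x$, one has $\omega_x(p,r)\ge\omega_x(p,s)+\omega_x(s,r)$ whenever $p\le s\le r$ in $\Omega_x$, $\omega_x(p,r)=0$ unless $p\le r$, and $\omega_x(p,r)>0$ if and only if $p\ll r$; moreover $I^\pm(y)\cap\Omega_x\ne\emptyset$ for every $y\in\Omega_x$; (c) for all $p<r$ in $\Omega_x$ there is a causal curve $\sigma$ from $p$ to $r$ contained in $\Omega_x$ which minimizes $L_\ell$ among causal curves from $p$ to $r$ contained in $\Omega_x$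 and satisfies $-L_\ell(\sigma)=\omega_x(p,r)\le\ell_-(p,r)$. A Lorentzian length space (in the sense of Kunzinger and Sämann) is a Lorentzian prelength space that is locally causally closed, causally curve-connected, timelike curve-connected and localizable, and in which $\ell_-(x,y)=\sup\{-L_\ell(\sigma)\}$ for all $x,y\in M$, the supremum being over causal curves $\sigma$ from $x$ to $y$ (and equal to $0$ if there are none). *)

theory Defs
  imports "HOL-Analysis.Analysis"
begin

section \<open>Metric spacetimes\<close>

text \<open>
  The metric space \<open>(M, d)\<close> is the type \<open>'a\<close> with its \<open>dist\<close>. On the nonpositive values of a
  time separation function, the addition of \<open>ereal\<close> is unambiguous; \<open>\<infinity> + (-\<infinity>)\<close> never matters.
\<close>

definition metric_spacetime :: "('a::metric_space \<Rightarrow> 'a \<Rightarrow> ereal) \<Rightarrow> bool" where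
  "metric_spacetime l \<longleftrightarrow>
     (\<forall>x y. l x y \<le> 0 \<or> l x y = \<infinity>) \<and>
     (\<forall>x. l x x \<le> 0) \<and>
     (\<forall>x y z. max (l x y) (l y z) < \<infinity> \<longrightarrow> l x z \<le> l x y + l y z)"

definition causal_le :: "('a \<Rightarrow> 'a \<Rightarrow> ereal) \<Rightarrow> 'a \<Rightarrow> 'a \<Rightarrow> bool" where
  "causal_le l x y \<longleftrightarrow> l x y \<le> 0"

definition causal_less :: "('a \<Rightarrow> 'a \<Rightarrow> ereal) \<Rightarrow> 'a \<Rightarrow> 'a \<Rightarrow> bool" where
  "causal_less l x y \<longleftrightarrow> causal_le l x y \<and> x \<noteq> y"

definition chron :: "('a \<Rightarrow> 'a \<Rightarrow> ereal) \<Rightarrow> 'a \<Rightarrow> 'a \<Rightarrow> bool" where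
  "chron l x y \<longleftrightarrow> l x y < 0"

definition chron_future :: "('a \<Rightarrow> 'a \<Rightarrow> ereal) \<Rightarrow> 'a \<Rightarrow> 'a set" where
  "chron_future l x = {y. chron l x y}"

definition chron_past :: "('a \<Rightarrow> 'a \<Rightarrow> ereal) \<Rightarrow> 'a \<Rightarrow> 'a set" where
  "chron_past l x = {y. chron l y x}"

definition causal_diamond :: "('a \<Rightarrow> 'a \<Rightarrow> ereal) \<Rightarrow> 'a \<Rightarrow> 'a \<Rightarrow> 'a set" where
  "causal_diamond l x y = {z. causal_le l x z \<and> causal_le l z y}"

definition ell_minus :: "('a \<Rightarrow> 'a \<Rightarrow> ereal) \<Rightarrow> 'a \<Rightarrow> 'a \<Rightarrow> ereal" where
  "ell_minus l x y = max (- l x y) 0"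

section \<open>Causal curves and their lengths\<close>

text \<open>
  A path on an interval \<open>A\<close> is a total function \<open>real \<Rightarrow> 'a\<close> of which only the values on \<open>A\<close> matter.
\<close>

definition causal_path :: "('a \<Rightarrow> 'a \<Rightarrow> ereal) \<Rightarrow> real set \<Rightarrow> (real \<Rightarrow> 'a) \<Rightarrow> bool" where
  "causal_path l A \<sigma> \<longleftrightarrow>
     is_interval A \<and> (\<forall>s\<in>A. \<forall>t\<in>A. s < t \<longrightarrow> l (\<sigma> s) (\<sigma> t) \<le> 0)"

definition timelike_path :: "('a \<Rightarrow> 'a \<Rightarrow> ereal) \<Rightarrow> real set \<Rightarrow> (real \<Rightarrow> 'a) \<Rightarrow> bool" where
  "timelike_path l A \<sigma> \<longleftrightarrow>
     is_interval A \<and> (\<forall>s\<in>A. \<forall>t\<in>A. s < t \<longrightarrow> l (\<sigma> s) (\<sigma> t) < 0)"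

definition locally_lipschitz_on :: "real set \<Rightarrow> (real \<Rightarrow> 'a::metric_space) \<Rightarrow> bool" where
  "locally_lipschitz_on A \<sigma> \<longleftrightarrow> (\<forall>t\<in>A. \<exists>u>0. \<exists>K. K-lipschitz_on (cball t u \<inter> A) \<sigma>)"

definition causal_curve ::
    "('a::metric_space \<Rightarrow> 'a \<Rightarrow> ereal) \<Rightarrow> real set \<Rightarrow> (real \<Rightarrow> 'a) \<Rightarrow> bool" where
  "causal_curve l A \<sigma> \<longleftrightarrow>
     causal_path l A \<sigma> \<and> \<not> \<sigma> constant_on A \<and> locally_lipschitz_on A \<sigma>"

definition timelike_curve ::
    "('a::metric_space \<Rightarrow> 'a \<Rightarrow> ereal) \<Rightarrow> real set \<Rightarrow> (real \<Rightarrow> 'a) \<Rightarrow> bool" where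
  "timelike_curve l A \<sigma> \<longleftrightarrow> causal_curve l A \<sigma> \<and> timelike_path l A \<sigma>"

text \<open>Nonconstancy on \<open>{a..b}\<close> forces \<open>a < b\<close> here.\<close>

definition causal_curve_from_to ::
    "('a::metric_space \<Rightarrow> 'a \<Rightarrow> ereal) \<Rightarrow> 'a \<Rightarrow> 'a \<Rightarrow> real \<Rightarrow> real \<Rightarrow> (real \<Rightarrow> 'a) \<Rightarrow> bool" where
  "causal_curve_from_to l x y a b \<sigma> \<longleftrightarrow>
     causal_curve l {a..b} \<sigma> \<and> \<sigma> a = x \<and> \<sigma> b = y"

definition path_length :: "('a \<Rightarrow> 'a \<Rightarrow> ereal) \<Rightarrow> real \<Rightarrow> real \<Rightarrow> (real \<Rightarrow> 'a) \<Rightarrow> ereal" where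
  "path_length f a b \<sigma> =
     Sup {\<Sum>i=1..N. f (\<sigma> (s (i - 1))) (\<sigma> (s i)) | (N::nat) (s::nat \<Rightarrow> real).
            s 0 = a \<and> s N = b \<and> strict_mono_on {0..N} s}"

text \<open>
  The supremum is the right one for \<open>L_ell\<close> as well: \<open>l \<le> 0\<close> along causal paths and its triangle
  inequality make the sums increase under refinement, so a longest curve has the least \<open>L_ell\<close>.
\<close>

abbreviation L_ell :: "('a \<Rightarrow> 'a \<Rightarrow> ereal) \<Rightarrow> real \<Rightarrow> real \<Rightarrow> (real \<Rightarrow> 'a) \<Rightarrow> ereal" where
  "L_ell l a b \<sigma> \<equiv> path_length l a b \<sigma>"

definition L_d :: "real \<Rightarrow> real \<Rightarrow> (real \<Rightarrow> 'a::metric_space) \<Rightarrow> ereal" where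
  "L_d a b \<sigma> = path_length (\<lambda>x y. ereal (dist x y)) a b \<sigma>"

definition ell_curve :: "('a::metric_space \<Rightarrow> 'a \<Rightarrow> ereal) \<Rightarrow> (real \<Rightarrow> 'a) \<Rightarrow> bool" where
  "ell_curve l \<sigma> \<longleftrightarrow> causal_curve l {0..1} \<sigma> \<and> L_ell l 0 1 \<sigma> = l (\<sigma> 0) (\<sigma> 1)"

section \<open>Causality conditions\<close>

definition non_totally_imprisoning :: "('a::metric_space \<Rightarrow> 'a \<Rightarrow> ereal) \<Rightarrow> bool" where
  "non_totally_imprisoning l \<longleftrightarrow>
     (\<forall>K. compact K \<longrightarrow>
        (\<exists>C::real. \<forall>a b \<sigma>. causal_curve l {a..b} \<sigma> \<and> \<sigma> ` {a..b} \<subseteq> K \<longrightarrow> L_d a b \<sigma> \<le> ereal C))"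

definition globally_hyperbolic :: "('a::metric_space \<Rightarrow> 'a \<Rightarrow> ereal) \<Rightarrow> bool" where
  "globally_hyperbolic l \<longleftrightarrow>
     non_totally_imprisoning l \<and> (\<forall>x y. compact (causal_diamond l x y))"

definition timelike_curve_connected :: "('a::metric_space \<Rightarrow> 'a \<Rightarrow> ereal) \<Rightarrow> bool" where
  "timelike_curve_connected l \<longleftrightarrow>
     (\<forall>x y. chron l x y \<longrightarrow> (\<exists>a b \<sigma>. timelike_curve l {a..b} \<sigma> \<and> \<sigma> a = x \<and> \<sigma> b = y))"

definition causally_curve_connected :: "('a::metric_space \<Rightarrow> 'a \<Rightarrow> ereal) \<Rightarrow> bool" where
  "causally_curve_connected l \<longleftrightarrow>
     (\<forall>x y. causal_le l x y \<and> x \<noteq> y \<longrightarrow> (\<exists>a b \<sigma>. causal_curve_from_to l x y a b \<sigma>))"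

definition chron_geodesic_space :: "('a::metric_space \<Rightarrow> 'a \<Rightarrow> ereal) \<Rightarrow> bool" where
  "chron_geodesic_space l \<longleftrightarrow>
     metric_spacetime l \<and>
     (\<forall>x y. chron l x y \<longrightarrow> (\<exists>\<sigma>. ell_curve l \<sigma> \<and> \<sigma> 0 = x \<and> \<sigma> 1 = y))"

section \<open>Lorentzian length spaces\<close>

definition lower_semicontinuous :: "('b::topological_space \<Rightarrow> ereal) \<Rightarrow> bool" where
  "lower_semicontinuous f \<longleftrightarrow> (\<forall>c. open {p. c < f p})"

definition lorentzian_prelength_space :: "('a::metric_space \<Rightarrow> 'a \<Rightarrow> ereal) \<Rightarrow> bool" where
  "lorentzian_prelength_space l \<longleftrightarrow>
     metric_spacetime l \<and> lower_semicontinuous (\<lambda>(x, y). ell_minus l x y)"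

definition locally_causally_closed :: "('a::metric_space \<Rightarrow> 'a \<Rightarrow> ereal) \<Rightarrow> bool" where
  "locally_causally_closed l \<longleftrightarrow>
     (\<forall>x. \<exists>U. x \<in> interior U \<and>
        closedin (top_of_set (U \<times> U)) {(y, z). y \<in> U \<and> z \<in> U \<and> causal_le l y z})"

text \<open>
  The next three predicates are the three requirements on a localizing neighbourhood \<open>\<Omega>\<close> with its
  local time separation \<open>\<omega>\<close>.
\<close>

definition curve_length_bounded :: "('a::metric_space \<Rightarrow> 'a \<Rightarrow> ereal) \<Rightarrow> 'a set \<Rightarrow> bool" where
  "curve_length_bounded l \<Omega> \<longleftrightarrow>
     (\<exists>C::real. C > 0 \<and>
        (\<forall>a b \<sigma>. causal_curve l {a..b} \<sigma> \<and> \<sigma> ` {a..b} \<subseteq> \<Omega> \<longrightarrow> L_d a b \<sigma> \<le> ereal C))"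

definition local_time_separation ::
    "('a::metric_space \<Rightarrow> 'a \<Rightarrow> ereal) \<Rightarrow> 'a set \<Rightarrow> ('a \<Rightarrow> 'a \<Rightarrow> real) \<Rightarrow> bool" where
  "local_time_separation l \<Omega> \<omega> \<longleftrightarrow>
     continuous_on (\<Omega> \<times> \<Omega>) (\<lambda>(p, r). \<omega> p r) \<and>
     (\<forall>p\<in>\<Omega>. \<forall>r\<in>\<Omega>. 0 \<le> \<omega> p r) \<and>
     (\<forall>p\<in>\<Omega>. \<forall>s\<in>\<Omega>. \<forall>r\<in>\<Omega>. causal_le l p s \<and> causal_le l s r \<longrightarrow> \<omega> p r \<ge> \<omega> p s + \<omega> s r) \<and>
     (\<forall>p\<in>\<Omega>. \<forall>r\<in>\<Omega>. \<not> causal_le l p r \<longrightarrow> \<omega> p r = 0) \<and>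
     (\<forall>p\<in>\<Omega>. \<forall>r\<in>\<Omega>. \<omega> p r > 0 \<longleftrightarrow> chron l p r) \<and>
     (\<forall>y\<in>\<Omega>. chron_future l y \<inter> \<Omega> \<noteq> {} \<and> chron_past l y \<inter> \<Omega> \<noteq> {})"

definition locally_maximizing ::
    "('a::metric_space \<Rightarrow> 'a \<Rightarrow> ereal) \<Rightarrow> 'a set \<Rightarrow> ('a \<Rightarrow> 'a \<Rightarrow> real) \<Rightarrow> bool" where
  "locally_maximizing l \<Omega> \<omega> \<longleftrightarrow>
     (\<forall>p\<in>\<Omega>. \<forall>r\<in>\<Omega>. causal_less l p r \<longrightarrow>
        (\<exists>a b \<sigma>. causal_curve_from_to l p r a b \<sigma> \<and> \<sigma> ` {a..b} \<subseteq> \<Omega> \<and>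
           (\<forall>a' b' \<sigma>'. causal_curve_from_to l p r a' b' \<sigma>' \<and> \<sigma>' ` {a'..b'} \<subseteq> \<Omega> \<longrightarrow>
              L_ell l a b \<sigma> \<le> L_ell l a' b' \<sigma>') \<and>
           - L_ell l a b \<sigma> = ereal (\<omega> p r) \<and> ereal (\<omega> p r) \<le> ell_minus l p r))"

definition localizable :: "('a::metric_space \<Rightarrow> 'a \<Rightarrow> ereal) \<Rightarrow> bool" where
  "localizable l \<longleftrightarrow>
     (\<forall>x. \<exists>\<Omega>. open \<Omega> \<and> x \<in> \<Omega> \<and> curve_length_bounded l \<Omega> \<and>
        (\<exists>\<omega>. local_time_separation l \<Omega> \<omega> \<and> locally_maximizing l \<Omega> \<omega>))"

definition curve_separation :: "('a::metric_space \<Rightarrow> 'a \<Rightarrow> ereal) \<Rightarrow> 'a \<Rightarrow> 'a \<Rightarrow> ereal" where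
  "curve_separation l x y =
     (if \<exists>a b \<sigma>. causal_curve_from_to l x y a b \<sigma>
      then Sup {- L_ell l a b \<sigma> | a b \<sigma>. causal_curve_from_to l x y a b \<sigma>}
      else 0)"

definition lorentzian_length_space :: "('a::metric_space \<Rightarrow> 'a \<Rightarrow> ereal) \<Rightarrow> bool" where
  "lorentzian_length_space l \<longleftrightarrow>
     lorentzian_prelength_space l \<and>
     locally_causally_closed l \<and>
     causally_curve_connected l \<and>
     timelike_curve_connected l \<and>
     localizable l \<and>
     (\<forall>x y. ell_minus l x y = curve_separation l x y)"

end

theory Submission
  imports Defs
begin

text \<open>
  Both directions rest on limit curves. Causal curves in a compact set have bounded \<open>d\<close>-length by
  global hyperbolicity, so parametrized on \<open>[0,1]\<close> they share a Lipschitz constant, and a cluster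
  point of a sequence of them is again causal: the causal relation is closed locally, hence, by
  subdividing, along the curve.

  In a Lorentzian length space, curves with end points \<open>x\<^sub>n \<rightarrow> p\<close> and \<open>y\<^sub>n \<rightarrow> q\<close> eventually lie in a
  common causal diamond, so the causal relation is closed. The local time separations make length
  upper semicontinuous and bounded along limit curves; since \<open>\<ell>\<^sub>-\<close> is a supremum of lengths, it is
  attained, finite and upper semicontinuous.

  Conversely, curves joining causally related points \<open>x \<noteq> y\<close> arise as limits of \<open>\<ell>\<close>-curves from
  \<open>x\<close> to points \<open>y\<^sub>n\<close> decreasing to \<open>y\<close> along a timelike curve, and \<open>I\<^sup>+(y) \<inter> I\<^sup>-(z)\<close> with
  the restriction of \<open>\<ell>\<^sub>-\<close> is a localizing neighbourhood of each of its points.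
\<close>

section \<open>Lengths as suprema of chains\<close>

text \<open>Partition sums with the left end fixed and the right end growing, so that the indexed
  partitions in \<open>path_length\<close> can be handled by rule induction. The rule
  \<open>refl\<close> is the partition with \<open>N = 0\<close>, which exists only over a
  degenerate interval.\<close>

inductive chain_sum :: "('a \<Rightarrow> 'a \<Rightarrow> ereal) \<Rightarrow> (real \<Rightarrow> 'a) \<Rightarrow> real \<Rightarrow> real \<Rightarrow> ereal \<Rightarrow> bool"
  for f \<sigma> a where
  refl: "chain_sum f \<sigma> a a 0"
| step: "chain_sum f \<sigma> a c v \<Longrightarrow> c < b \<Longrightarrow> chain_sum f \<sigma> a b (v + f (\<sigma> c) (\<sigma> b))"

lemma chain_sum_imp_le: "chain_sum f \<sigma> a b v \<Longrightarrow> a \<le> b"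
  by (induction rule: chain_sum.induct) auto

lemma chain_sum_single: "a < b \<Longrightarrow> chain_sum f \<sigma> a b (f (\<sigma> a) (\<sigma> b))"
  using chain_sum.step[OF chain_sum.refl, of a b f \<sigma>] by simp

lemma chain_sum_trans:
  "chain_sum f \<sigma> c b w \<Longrightarrow> chain_sum f \<sigma> a c v \<Longrightarrow> chain_sum f \<sigma> a b (v + w)"
proof (induction rule: chain_sum.induct)
  case (step d w b)
  then show ?case
    using chain_sum.step[of f \<sigma> a d "v + w" b] by (simp add: add.assoc)
qed simp

lemma chain_sum_partition:
  "chain_sum f \<sigma> a b v \<longleftrightarrow>
    (\<exists>(N::nat) (s::nat \<Rightarrow> real). v = (\<Sum>i=1..N. f (\<sigma> (s (i - 1))) (\<sigma> (s i))) \<and>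
      s 0 = a \<and> s N = b \<and> strict_mono_on {0..N} s)"
  (is "_ \<longleftrightarrow> ?P b v")
proof
  show "?P b v" if "chain_sum f \<sigma> a b v"
    using that
  proof (induction rule: chain_sum.induct)
    case refl
    show ?case
      by (rule exI[of _ 0], rule exI[of _ "\<lambda>_. a"]) (auto simp: strict_mono_on_def)
  next
    case (step c v b)
    then obtain N and s :: "nat \<Rightarrow> real" where s: "v = (\<Sum>i=1..N. f (\<sigma> (s (i - 1))) (\<sigma> (s i)))"
      "s 0 = a" "s N = c" "strict_mono_on {0..N} s" by blast
    define s' where "s' = s(Suc N := b)"
    have "s i < b" if "i \<le> N" for i
    proof -
      have "s i \<le> s N"
        using s(4) that by (cases "i = N") (auto simp: strict_mono_on_def less_imp_le)
      with s(3) step.hyps(2) show ?thesis by simp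
    qed
    then have "strict_mono_on {0..Suc N} s'"
      using s(4) by (auto simp: strict_mono_on_def le_Suc_eq s'_def)
    moreover have "(\<Sum>i=1..N. f (\<sigma> (s' (i - 1))) (\<sigma> (s' i))) = v"
      unfolding s(1) by (rule sum.cong) (auto simp: s'_def)
    then have "(\<Sum>i=1..Suc N. f (\<sigma> (s' (i - 1))) (\<sigma> (s' i))) = v + f (\<sigma> c) (\<sigma> b)"
      using s(3) by (simp add: s'_def)
    moreover have "s' 0 = a" "s' (Suc N) = b"
      using s(2) by (simp_all add: s'_def)
    ultimately show ?case by metis
  qed
  show "chain_sum f \<sigma> a b v" if "?P b v"
  proof -
    from that obtain N and s :: "nat \<Rightarrow> real" where s: "v = (\<Sum>i=1..N. f (\<sigma> (s (i - 1))) (\<sigma> (s i)))"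
      "s 0 = a" "s N = b" "strict_mono_on {0..N} s" by blast
    have "chain_sum f \<sigma> (s 0) (s k) (\<Sum>i=1..k. f (\<sigma> (s (i - 1))) (\<sigma> (s i)))" if "k \<le> N" for k
      using that
    proof (induction k)
      case 0
      then show ?case by (simp add: chain_sum.refl)
    next
      case (Suc k)
      then have "s k < s (Suc k)" using s(4) by (auto simp: strict_mono_on_def)
      from chain_sum.step[OF Suc.IH this] Suc.prems show ?case by simp
    qed
    from this[of N] s show ?thesis by simp
  qed
qed

lemma path_length_eq_Sup_chain_sum: "path_length f a b \<sigma> = Sup {v. chain_sum f \<sigma> a b v}"
  unfolding path_length_def chain_sum_partition by (rule arg_cong[of _ _ Sup]) blast

lemma chain_sum_le_path_length: "chain_sum f \<sigma> a b v \<Longrightarrow> v \<le> path_length f a b \<sigma>"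
  unfolding path_length_eq_Sup_chain_sum by (rule Sup_upper) simp

lemma path_length_le:
  "(\<And>v. chain_sum f \<sigma> a b v \<Longrightarrow> v \<le> B) \<Longrightarrow> path_length f a b \<sigma> \<le> B"
  unfolding path_length_eq_Sup_chain_sum by (rule Sup_least) simp

lemma le_path_length: "a < b \<Longrightarrow> f (\<sigma> a) (\<sigma> b) \<le> path_length f a b \<sigma>"
  by (rule chain_sum_le_path_length[OF chain_sum_single])

lemma ex_chain_sum: "a \<le> b \<Longrightarrow> \<exists>v. chain_sum f \<sigma> a b v"
  using chain_sum.refl[of f \<sigma> a] chain_sum_single[of a b f \<sigma>] by (cases "a = b") auto

text \<open>Chains up to \<open>c\<close> and from \<open>c\<close> concatenate to chains through
  \<open>c\<close>. Both lengths being at most 0 excludes sums of opposite infinities; the value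
  \<open>-\<infinity>\<close> is split off because adding a constant commutes with
  \<open>SUP\<close> only for constants other than \<open>-\<infinity>\<close>.\<close>

lemma path_length_superadditive:
  assumes "a \<le> c" "c \<le> b" "path_length f a c \<sigma> \<le> 0" "path_length f c b \<sigma> \<le> 0"
  shows "path_length f a c \<sigma> + path_length f c b \<sigma> \<le> path_length f a b \<sigma>"
proof (cases "path_length f a c \<sigma> = -\<infinity>")
  case True
  with assms(4) show ?thesis by (cases "path_length f c b \<sigma>") auto
next
  case ac: False
  have *: "path_length f a c \<sigma> + w \<le> path_length f a b \<sigma>" if "chain_sum f \<sigma> c b w" for w
  proof (cases "w = -\<infinity>")
    case True
    with assms(3) show ?thesis by (cases "path_length f a c \<sigma>") auto
  next
    case False
    have "(SUP v\<in>{v. chain_sum f \<sigma> a c v}. v + w) \<le> path_length f a b \<sigma>"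
      using chain_sum_trans[OF that] by (intro SUP_least chain_sum_le_path_length) auto
    moreover have "(SUP v\<in>{v. chain_sum f \<sigma> a c v}. v + w) = path_length f a c \<sigma> + w"
      using SUP_ereal_add_left[of "{v. chain_sum f \<sigma> a c v}" w "\<lambda>v. v"] False
        ex_chain_sum[OF assms(1)] unfolding path_length_eq_Sup_chain_sum by force
    ultimately show ?thesis by simp
  qed
  have "(SUP w\<in>{w. chain_sum f \<sigma> c b w}. path_length f a c \<sigma> + w) \<le> path_length f a b \<sigma>"
    using * by (auto intro!: SUP_least)
  moreover have "(SUP w\<in>{w. chain_sum f \<sigma> c b w}. path_length f a c \<sigma> + w)
      = path_length f a c \<sigma> + path_length f c b \<sigma>"
    using SUP_ereal_add_right[of "{v. chain_sum f \<sigma> c b v}" "path_length f a c \<sigma>" "\<lambda>v. v"] ac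
      ex_chain_sum[OF assms(2)] unfolding path_length_eq_Sup_chain_sum by force
  ultimately show ?thesis by simp
qed

lemma chain_sum_reparametrize:
  assumes "strict_mono_on {a..b} h" "chain_sum f (\<sigma> \<circ> h) a c v" "c \<le> b"
  shows "chain_sum f \<sigma> (h a) (h c) v"
  using assms(2,3)
proof (induction rule: chain_sum.induct)
  case refl
  show ?case by (rule chain_sum.refl)
next
  case (step c v d)
  have "h c < h d"
    using assms(1) step chain_sum_imp_le[OF step.hyps(1)] by (auto simp: strict_mono_on_def)
  with step chain_sum.step[of f \<sigma> "h a" "h c" v "h d"] show ?case by simp
qed

text \<open>Chains of \<open>\<sigma> \<circ> h\<close> are chains of \<sigma> through values of
  \<open>h\<close>. The map \<open>h\<close> may jump, so only one inequality holds; for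
  \<open>l\<close> it says that \<open>- L_ell\<close> does not drop.\<close>

lemma path_length_reparametrize:
  assumes "strict_mono_on {a..b} h"
  shows "path_length f a b (\<sigma> \<circ> h) \<le> path_length f (h a) (h b) \<sigma>"
  using chain_sum_reparametrize[OF assms]
  by (intro path_length_le chain_sum_le_path_length) auto

section \<open>Arclength reparametrization\<close>

text \<open>Bisection: two adjacent intervals share the larger of their constants, because the
  estimates on both sides of the common end point add up.\<close>

lemma locally_lipschitz_on_interval_imp_lipschitz:
  assumes "locally_lipschitz_on {a..b} \<sigma>" "a \<le> b"
  obtains K where "K-lipschitz_on {a..b} \<sigma>"
proof -
  \<comment> \<open>The intervals in the local case of \<open>Bolzano\<close> may stick out of
    \<open>{a..b}\<close>, hence the clamping with \<open>max\<close> and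
    \<open>min\<close>.\<close>
  define P where "P c d \<longleftrightarrow> (\<exists>K\<ge>0. \<forall>s t. max a c \<le> s \<and> s \<le> t \<and> t \<le> min b d \<longrightarrow>
    dist (\<sigma> s) (\<sigma> t) \<le> K * (t - s))" for c d
  have "P a b"
    using assms(2)
  proof (induction rule: Bolzano)
    case (trans c d e)
    from trans(1) obtain K where K: "K \<ge> 0" "\<And>s t. max a c \<le> s \<Longrightarrow> s \<le> t \<Longrightarrow> t \<le> min b d \<Longrightarrow>
      dist (\<sigma> s) (\<sigma> t) \<le> K * (t - s)" unfolding P_def by blast
    from trans(2) obtain L where L: "L \<ge> 0" "\<And>s t. max a d \<le> s \<Longrightarrow> s \<le> t \<Longrightarrow> t \<le> min b e \<Longrightarrow>
      dist (\<sigma> s) (\<sigma> t) \<le> L * (t - s)" unfolding P_def by blast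
    have "dist (\<sigma> s) (\<sigma> t) \<le> max K L * (t - s)" if "max a c \<le> s" "s \<le> t" "t \<le> min b e" for s t
    proof -
      have K': "dist (\<sigma> s') (\<sigma> t') \<le> max K L * (t' - s')"
        if "max a c \<le> s'" "s' \<le> t'" "t' \<le> min b d" for s' t'
        using K(2)[of s' t'] mult_right_mono[of K "max K L" "t' - s'"] that by simp
      have L': "dist (\<sigma> s') (\<sigma> t') \<le> max K L * (t' - s')"
        if "max a d \<le> s'" "s' \<le> t'" "t' \<le> min b e" for s' t'
        using L(2)[of s' t'] mult_right_mono[of L "max K L" "t' - s'"] that by simp
      consider "t \<le> d" | "d \<le> s" | "s \<le> d" "d \<le> t" by linarith
      then show ?thesis
      proof cases
        case 3
        then show ?thesis
          using K'[of s d] L'[of d t] dist_triangle[of "\<sigma> s" "\<sigma> t" "\<sigma> d"] that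
          by (simp add: right_diff_distrib)
      qed (use that K'[of s t] L'[of s t] in auto)
    qed
    then show ?case
      unfolding P_def using K(1) by (intro exI[of _ "max K L"]) auto
  next
    case (local x)
    then obtain u K where u: "u > 0" "K-lipschitz_on (cball x u \<inter> {a..b}) \<sigma>"
      using assms(1) unfolding locally_lipschitz_on_def by (metis atLeastAtMost_iff)
    have "P c d" if "c \<le> x" "x \<le> d" "d - c < u" for c d
      unfolding P_def
    proof (intro exI[of _ K] conjI allI impI)
      show "0 \<le> K" using u(2) by (rule lipschitz_on_nonneg)
      fix s t assume "max a c \<le> s \<and> s \<le> t \<and> t \<le> min b d"
      then show "dist (\<sigma> s) (\<sigma> t) \<le> K * (t - s)"
        using lipschitz_onD[OF u(2), of s t] that by (auto simp: dist_real_def)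
    qed
    with u(1) show ?case by blast
  qed
  then obtain K where K: "K \<ge> 0" "\<And>s t. a \<le> s \<Longrightarrow> s \<le> t \<Longrightarrow> t \<le> b \<Longrightarrow> dist (\<sigma> s) (\<sigma> t) \<le> K * (t - s)"
    unfolding P_def by auto
  have "K-lipschitz_on {a..b} \<sigma>"
  proof (rule lipschitz_onI[OF _ K(1)])
    fix s t assume "s \<in> {a..b}" "t \<in> {a..b}"
    then show "dist (\<sigma> s) (\<sigma> t) \<le> K * dist s t"
      using K(2)[of s t] K(2)[of t s] by (cases "s \<le> t") (auto simp: dist_real_def dist_commute)
  qed
  then show thesis by (rule that)
qed

text \<open>Arclength grows at rate at most \<open>K\<close>. This makes it a continuous function of
  the parameter, to which the intermediate value theorem applies.\<close>

lemma L_d_lipschitz_step: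
  fixes \<sigma> :: "real \<Rightarrow> 'a::metric_space"
  assumes K: "K-lipschitz_on {a..b} \<sigma>" and V: "L_d a s \<sigma> = ereal V"
    and st: "a \<le> s" "s \<le> t" "t \<le> b"
  shows "L_d a t \<sigma> \<le> ereal (V + K * (t - s))"
proof -
  have K': "dist (\<sigma> s') (\<sigma> t') \<le> K * (t' - s')" if "a \<le> s'" "s' \<le> t'" "t' \<le> b" for s' t'
    using lipschitz_onD[OF K, of s' t'] that by (simp add: dist_real_def)
  define d where "d = (\<lambda>x y :: 'a. ereal (dist x y))"
  \<comment> \<open>Invariant for a chain that need not pass through \<open>s\<close>: before
    \<open>s\<close>, closing it with a link to \<open>s\<close> costs at most \<open>V\<close>;
    from \<open>s\<close> on, its excess over \<open>V\<close> is at most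
    \<open>K * (t - s)\<close>.\<close>
  have "t \<le> b \<longrightarrow> (if s \<le> t then v \<le> ereal (V + K * (t - s)) else v + dist (\<sigma> t) (\<sigma> s) \<le> ereal V)"
    if "chain_sum d \<sigma> a t v" for t v
    using that
  proof (induction rule: chain_sum.induct)
    case refl
    have "L_d a s \<sigma> \<ge> d (\<sigma> a) (\<sigma> s)" if "a < s"
      unfolding L_d_def d_def by (rule le_path_length[OF that, of "\<lambda>x y. ereal (dist x y)"])
    moreover have "L_d a s \<sigma> \<ge> 0" if "a = s"
      unfolding L_d_def using that by (auto intro: chain_sum_le_path_length chain_sum.refl)
    ultimately show ?case
      using V st by (auto simp: zero_ereal_def d_def)
  next
    case (step c v t)
    show ?case
    proof
      assume tb: "t \<le> b"
      from step.hyps(1) have ac: "a \<le> c" by (rule chain_sum_imp_le)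
      consider "s \<le> c" | "c < s" "s \<le> t" | "t < s" by linarith
      then show "if s \<le> t then v + d (\<sigma> c) (\<sigma> t) \<le> ereal (V + K * (t - s))
        else v + d (\<sigma> c) (\<sigma> t) + dist (\<sigma> t) (\<sigma> s) \<le> ereal V"
      proof cases
        case 1
        then have "v \<le> ereal (V + K * (c - s))" "dist (\<sigma> c) (\<sigma> t) \<le> K * (t - c)"
          using step tb ac K'[of c t] by auto
        with 1 step.hyps show ?thesis
          by (cases v) (auto simp: d_def algebra_simps)
      next
        \<comment> \<open>The link that jumps over \<open>s\<close> is split at \<open>s\<close> by
          the triangle inequality.\<close>
        case 2
        then have "v + dist (\<sigma> c) (\<sigma> s) \<le> ereal V" "dist (\<sigma> s) (\<sigma> t) \<le> K * (t - s)"
          using step tb st K'[of s t] by auto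
        moreover have "dist (\<sigma> c) (\<sigma> t) \<le> dist (\<sigma> c) (\<sigma> s) + dist (\<sigma> s) (\<sigma> t)"
          by (rule dist_triangle)
        ultimately show ?thesis
          using 2 by (cases v) (auto simp: d_def algebra_simps)
      next
        case 3
        then have "v + dist (\<sigma> c) (\<sigma> s) \<le> ereal V"
          using step tb by auto
        moreover have "chain_sum d \<sigma> a s (v + d (\<sigma> c) (\<sigma> t) + d (\<sigma> t) (\<sigma> s))"
          using step.hyps 3 by (intro chain_sum.step)
        then have "v + d (\<sigma> c) (\<sigma> t) + d (\<sigma> t) (\<sigma> s) \<le> ereal V"
          using chain_sum_le_path_length[of d \<sigma> a s] V unfolding L_d_def d_def by simp
        ultimately show ?thesis
          using 3 by (auto simp: d_def)
      qed
    qed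
  qed
  then show ?thesis
    using st unfolding L_d_def d_def by (intro path_length_le) auto
qed

lemma dist_add_L_d_le:
  assumes "s < t"
  shows "L_d a s \<sigma> + dist (\<sigma> s) (\<sigma> t) \<le> L_d a t \<sigma>"
proof -
  have "v \<le> L_d a t \<sigma> - dist (\<sigma> s) (\<sigma> t)" if "chain_sum (\<lambda>x y. ereal (dist x y)) \<sigma> a s v" for v
    using chain_sum_le_path_length[OF chain_sum.step[OF that assms]] unfolding L_d_def
    by (simp add: ereal_le_minus)
  then have "L_d a s \<sigma> \<le> L_d a t \<sigma> - dist (\<sigma> s) (\<sigma> t)"
    unfolding L_d_def[of a s] by (rule path_length_le)
  then show ?thesis by (simp add: ereal_le_minus)
qed

text \<open>
  The parameter is arclength plus a multiple of the old parameter, so that the change of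
  parameter is strictly increasing even where the curve rests.
\<close>

lemma bounded_length_reparametrization:
  assumes ab: "a < b" and K: "K-lipschitz_on {a..b} \<sigma>" and C: "L_d a b \<sigma> \<le> ereal C"
  obtains h :: "real \<Rightarrow> real" where "strict_mono_on {0..1} h" "h 0 = a" "h 1 = b" "range h \<subseteq> {a..b}"
    "(C + 1)-lipschitz_on {0..1} (\<sigma> \<circ> h)"
proof -
  have Vaa: "L_d a a \<sigma> = 0"
  proof -
    have "v = 0" if "chain_sum (\<lambda>x y. ereal (dist x y)) \<sigma> a a v" for v
      using that by cases (auto dest: chain_sum_imp_le)
    then show ?thesis
      unfolding L_d_def
      by (intro antisym path_length_le chain_sum_le_path_length chain_sum.refl) auto
  qed
  have Vfin: "\<bar>L_d a t \<sigma>\<bar> \<noteq> \<infinity>" if "t \<in> {a..b}" for t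
  proof -
    have "0 \<le> L_d a t \<sigma>"
      using that le_path_length[of a t "\<lambda>x y. ereal (dist x y)" \<sigma>] Vaa
      by (cases "t = a") (auto simp: L_d_def intro: order_trans[rotated])
    moreover have "L_d a t \<sigma> \<le> ereal (0 + K * (t - a))"
      using that Vaa by (intro L_d_lipschitz_step[OF K]) (auto simp: zero_ereal_def)
    ultimately show ?thesis by auto
  qed
  define V where "V t = real_of_ereal (L_d a t \<sigma>)" for t
  have V: "L_d a t \<sigma> = ereal (V t)" if "t \<in> {a..b}" for t
    using Vfin[OF that] by (auto simp: V_def ereal_real)
  have V_lower: "V s + dist (\<sigma> s) (\<sigma> t) \<le> V t" if "a \<le> s" "s \<le> t" "t \<le> b" for s t
    using dist_add_L_d_le[of s t a \<sigma>] V[of s] V[of t] that by (cases "s = t") auto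
  have V_upper: "V t \<le> V s + K * (t - s)" if "a \<le> s" "s \<le> t" "t \<le> b" for s t
    using L_d_lipschitz_step[OF K V[of s], of t] V[of t] that by auto
  have V_mono: "V s \<le> V t" if "a \<le> s" "s \<le> t" "t \<le> b" for s t
    using V_lower[OF that] zero_le_dist[of "\<sigma> s" "\<sigma> t"] by linarith
  define W where "W t = V t + (t - a) / (b - a)" for t
  have W_mono: "W s < W t" and W_dist: "dist (\<sigma> s) (\<sigma> t) \<le> W t - W s"
    if "a \<le> s" "s < t" "t \<le> b" for s t
    using V_lower[of s t] that ab divide_strict_right_mono[of "s - a" "t - a" "b - a"]
      zero_le_dist[of "\<sigma> s" "\<sigma> t"] unfolding W_def by linarith+
  have "K-lipschitz_on {a..b} V"
  proof (rule lipschitz_onI[OF _ lipschitz_on_nonneg[OF K]])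
    fix s t assume "s \<in> {a..b}" "t \<in> {a..b}"
    then show "dist (V s) (V t) \<le> K * dist s t"
      using V_mono[of s t] V_mono[of t s] V_upper[of s t] V_upper[of t s]
      by (cases "s \<le> t") (auto simp: dist_real_def)
  qed
  then have "continuous_on {a..b} V" by (rule lipschitz_on_continuous_on)
  then have W_cont: "continuous_on {a..b} W"
    unfolding W_def using ab by (intro continuous_intros) auto
  have Wa: "W a = 0" by (simp add: W_def V_def Vaa)
  \<comment> \<open>The linear term in \<open>W\<close> rises by exactly 1 over
    \<open>{a..b}\<close>; this is the 1 in the constant \<open>C + 1\<close>.\<close>
  have Wb: "0 < W b" "W b \<le> C + 1"
    using W_mono[of a b] Wa ab V[of b] C by (auto simp: W_def)
  \<comment> \<open>Outside \<open>{0..1}\<close> the value of \<open>h\<close> is arbitrary in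
    \<open>{a..b}\<close>. Thus \<open>\<sigma> \<circ> h\<close> takes all its values on the curve,
    and the compactness argument can use a product over all of \<open>real\<close>.\<close>
  have "\<exists>t. a \<le> t \<and> t \<le> b \<and> (u \<in> {0..1} \<longrightarrow> W t = u * W b)" for u
  proof (cases "u \<in> {0..1}")
    case True
    then have "W a \<le> u * W b" "u * W b \<le> W b"
      using Wa Wb(1) by (auto simp: mult_left_le_one_le)
    from IVT'[OF this less_imp_le[OF ab] W_cont] show ?thesis by blast
  qed (use ab in auto)
  then obtain h where h: "\<And>u. a \<le> h u \<and> h u \<le> b \<and> (u \<in> {0..1} \<longrightarrow> W (h u) = u * W b)"
    using choice[of "\<lambda>u t. a \<le> t \<and> t \<le> b \<and> (u \<in> {0..1} \<longrightarrow> W t = u * W b)"] by blast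
  have W_inj: "s = t" if "W s = W t" "s \<in> {a..b}" "t \<in> {a..b}" for s t
    using W_mono[of s t] W_mono[of t s] that by (cases s t rule: linorder_cases) auto
  have h_less: "h u < h v" if "u < v" "u \<in> {0..1}" "v \<in> {0..1}" for u v
  proof -
    have "W (h u) < W (h v)" using h[of u] h[of v] that Wb(1) by simp
    then show ?thesis
      using W_mono[of "h v" "h u"] h[of u] h[of v] that
      by (cases "h u" "h v" rule: linorder_cases) auto
  qed
  have "(C + 1)-lipschitz_on {0..1} (\<sigma> \<circ> h)"
  proof (rule lipschitz_on_leI)
    fix u v :: real assume uv: "u \<in> {0..1}" "v \<in> {0..1}" "u \<le> v"
    have "dist (\<sigma> (h u)) (\<sigma> (h v)) \<le> W (h v) - W (h u)"
      using h_less[of u v] h[of u] h[of v] uv W_dist[of "h u" "h v"] by (cases "u = v") auto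
    also have "\<dots> = W b * (v - u)" using h[of u] h[of v] uv by (simp add: algebra_simps)
    also have "\<dots> \<le> (C + 1) * (v - u)" using Wb uv by (intro mult_right_mono) auto
    finally show "dist ((\<sigma> \<circ> h) u) ((\<sigma> \<circ> h) v) \<le> (C + 1) * dist u v"
      using uv by (simp add: dist_real_def)
  qed (use Wb in linarith)
  moreover have "h 0 = a" "h 1 = b"
    using W_inj[of "h 0" a] W_inj[of "h 1" b] h[of 0] h[of 1] Wa ab by auto
  moreover have "strict_mono_on {0..1} h" "range h \<subseteq> {a..b}"
    using h_less by (simp add: strict_mono_on_def) (use h in auto)
  ultimately show thesis by (intro that[of h])
qed

section \<open>Causality in metric spacetimes\<close>

lemma metric_spacetime_triangle:
  "metric_spacetime l \<Longrightarrow> l x y \<le> 0 \<Longrightarrow> l y z \<le> 0 \<Longrightarrow> l x z \<le> l x y + l y z"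
proof -
  assume "metric_spacetime l" and le: "l x y \<le> 0" "l y z \<le> 0"
  then have "\<forall>x y z. max (l x y) (l y z) < \<infinity> \<longrightarrow> l x z \<le> l x y + l y z"
    unfolding metric_spacetime_def by (elim conjE)
  moreover have "max (l x y) (l y z) < \<infinity>"
    using le by (auto simp: max_def)
  ultimately show "l x z \<le> l x y + l y z" by (elim allE impE)
qed

lemma metric_spacetime_refl: "metric_spacetime l \<Longrightarrow> l x x \<le> 0"
  by (simp add: metric_spacetime_def)

lemma causal_le_trans:
  assumes "metric_spacetime l" "causal_le l x y" "causal_le l y z"
  shows "causal_le l x z"
  using metric_spacetime_triangle[OF assms(1), of x y z] assms(2,3) add_mono[of "l x y" 0 "l y z" 0]
  by (simp add: causal_le_def order_trans[of "l x z" "l x y + l y z"])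

lemma chron_causal_le_trans:
  assumes "metric_spacetime l" "chron l x y" "causal_le l y z"
  shows "chron l x z"
proof -
  have "l x z \<le> l x y + l y z"
    using assms metric_spacetime_triangle[of l x y z] unfolding chron_def causal_le_def by auto
  also have "\<dots> \<le> l x y + 0"
    using assms(3) unfolding causal_le_def by (intro add_left_mono)
  also have "\<dots> < 0" using assms(2) unfolding chron_def by simp
  finally show ?thesis unfolding chron_def .
qed

lemma causal_le_chron_trans:
  assumes "metric_spacetime l" "causal_le l x y" "chron l y z"
  shows "chron l x z"
proof -
  have "l x z \<le> l x y + l y z"
    using assms metric_spacetime_triangle[of l x y z] unfolding chron_def causal_le_def by auto
  also have "\<dots> \<le> 0 + l y z"
    using assms(2) unfolding causal_le_def by (intro add_right_mono)
  also have "\<dots> < 0" using assms(3) unfolding chron_def by simp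
  finally show ?thesis unfolding chron_def .
qed

lemma chron_imp_causal_le: "chron l x y \<Longrightarrow> causal_le l x y"
  by (simp add: chron_def causal_le_def)

lemma ell_minus_pos_iff: "0 < ell_minus l x y \<longleftrightarrow> chron l x y"
  by (simp add: ell_minus_def chron_def less_max_iff_disj ereal_less_uminus_reorder)

lemma ell_minus_causal: "causal_le l x y \<Longrightarrow> ell_minus l x y = - l x y"
  by (simp add: ell_minus_def causal_le_def max_def ereal_uminus_le_0_iff)

lemma ell_minus_nonneg: "0 \<le> ell_minus l x y"
  by (simp add: ell_minus_def)

lemma ell_minus_triangle:
  assumes "metric_spacetime l" "causal_le l x y" "causal_le l y z"
  shows "ell_minus l x y + ell_minus l y z \<le> ell_minus l x z"
proof -
  \<comment> \<open>Negation distributes over this \<open>ereal\<close> sum because both terms are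
    at most 0.\<close>
  have *: "- (l x y + l y z) = - l x y + - l y z"
    using assms(2,3) unfolding causal_le_def by (cases "l x y"; cases "l y z") auto
  have "- (l x y + l y z) \<le> - l x z"
    using metric_spacetime_triangle[OF assms(1), of x y z] assms(2,3) by (simp add: causal_le_def)
  then show ?thesis
    using assms causal_le_trans[OF assms] unfolding * by (simp add: ell_minus_causal)
qed

section \<open>Causal paths and curves, causal diamonds, and bounds on \<open>L_ell\<close>\<close>

lemma causal_pathD:
  assumes "metric_spacetime l" "causal_path l {a..b} \<sigma>" "a \<le> s" "s \<le> t" "t \<le> b"
  shows "causal_le l (\<sigma> s) (\<sigma> t)"
  using assms metric_spacetime_refl[of l "\<sigma> s"]
  by (cases "s = t") (auto simp: causal_path_def causal_le_def)

lemma causal_path_subinterval: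
  "causal_path l {a..b} \<sigma> \<Longrightarrow> a \<le> c \<Longrightarrow> d \<le> b \<Longrightarrow> causal_path l {c..d} \<sigma>"
  by (auto simp: causal_path_def is_interval_cc)

lemma lipschitz_on_imp_locally: "K-lipschitz_on A \<sigma> \<Longrightarrow> locally_lipschitz_on A \<sigma>"
  unfolding locally_lipschitz_on_def
  using zero_less_one lipschitz_on_subset[of K A \<sigma>] by (meson Int_lower2)

text \<open>Limit arguments deliver Lipschitz causal paths; distinct end points supply the
  nonconstancy that makes them curves.\<close>

lemma causal_curve_from_toI:
  assumes "causal_path l {a..b} \<sigma>" "K-lipschitz_on {a..b} \<sigma>" "a \<le> b"
    "\<sigma> a = x" "\<sigma> b = y" "x \<noteq> y"
  shows "causal_curve_from_to l x y a b \<sigma>"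
proof -
  have "\<not> \<sigma> constant_on {a..b}"
    using assms(3-6) unfolding constant_on_def by (metis atLeastAtMost_iff order_refl)
  with assms lipschitz_on_imp_locally[OF assms(2)] show ?thesis
    by (simp add: causal_curve_from_to_def causal_curve_def)
qed

lemma causal_curve_less: "causal_curve l {a..b} \<sigma> \<Longrightarrow> a < b"
proof (rule ccontr)
  assume "causal_curve l {a..b} \<sigma>" "\<not> a < b"
  moreover have "\<sigma> constant_on {a..b}"
    using \<open>\<not> a < b\<close> by (cases "a = b") (auto simp: constant_on_def)
  ultimately show False by (simp add: causal_curve_def)
qed

text \<open>Under global hyperbolicity, this is what confines curves to a compact set.\<close>

lemma causal_curve_diamond:
  assumes "metric_spacetime l" "causal_curve_from_to l x y a b \<sigma>"
    "causal_le l p x" "causal_le l y q"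
  shows "\<sigma> ` {a..b} \<subseteq> causal_diamond l p q"
proof -
  have \<sigma>: "causal_path l {a..b} \<sigma>" "\<sigma> a = x" "\<sigma> b = y"
    using assms(2) by (simp_all add: causal_curve_from_to_def causal_curve_def)
  have "causal_le l p (\<sigma> t) \<and> causal_le l (\<sigma> t) q" if "t \<in> {a..b}" for t
    using causal_pathD[OF assms(1) \<sigma>(1), of a t] causal_pathD[OF assms(1) \<sigma>(1), of t b]
      causal_le_trans[OF assms(1,3)] causal_le_trans[OF assms(1) _ assms(4)] \<sigma>(2,3) that by simp
  then show ?thesis by (auto simp: causal_diamond_def)
qed

lemma causal_curve_from_to_le:
  assumes "metric_spacetime l" "causal_curve_from_to l x y a b \<sigma>"
  shows "causal_le l x y"
proof -
  have "causal_path l {a..b} \<sigma>" "\<sigma> a = x" "\<sigma> b = y" "a \<le> b"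
    using assms(2) causal_curve_less[of l a b \<sigma>]
    by (simp_all add: causal_curve_from_to_def causal_curve_def)
  with causal_pathD[OF assms(1), of a b \<sigma> a b] show ?thesis by simp
qed

lemma chain_sum_nonpos:
  assumes "causal_path l {a..b} \<sigma>" "chain_sum l \<sigma> a t v" "t \<le> b"
  shows "v \<le> 0"
  using assms(2,3)
proof (induction rule: chain_sum.induct)
  case (step c v t)
  have "l (\<sigma> c) (\<sigma> t) \<le> 0"
    using assms(1) step chain_sum_imp_le[OF step.hyps(1)] by (auto simp: causal_path_def)
  with step add_mono[of v 0 "l (\<sigma> c) (\<sigma> t)" 0] show ?case by simp
qed simp

lemma L_ell_nonpos: "causal_path l {a..b} \<sigma> \<Longrightarrow> L_ell l a b \<sigma> \<le> 0"
  using chain_sum_nonpos[of l a b \<sigma> b] by (blast intro: path_length_le)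

text \<open>The lower bound is the partition without interior points: no causal curve is longer than
  the separation of its end points.\<close>

lemma causal_curve_L_ell_bounds:
  assumes "causal_curve_from_to l x y a b \<sigma>"
  shows "l x y \<le> L_ell l a b \<sigma>" "L_ell l a b \<sigma> \<le> 0"
proof -
  have "causal_path l {a..b} \<sigma>" "\<sigma> a = x" "\<sigma> b = y" "a < b"
    using assms causal_curve_less[of l a b \<sigma>]
    by (simp_all add: causal_curve_from_to_def causal_curve_def)
  then show "l x y \<le> L_ell l a b \<sigma>" "L_ell l a b \<sigma> \<le> 0"
    using le_path_length[of a b l \<sigma>] L_ell_nonpos[of l a b \<sigma>] by simp_all
qed

text \<open>Only the limits are required to lie in \<open>V\<close>: since \<open>V\<close> is open,
  the approximating points eventually lie there too. Arbitrary filters are allowed because limit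
  curves are obtained along a filter on functions, not along a subsequence.\<close>

lemma locally_causally_closed_limit:
  assumes "locally_causally_closed l"
  obtains V where "open V" "x \<in> V"
    "\<And>F f g p q. F \<noteq> bot \<Longrightarrow> (f \<longlongrightarrow> p) F \<Longrightarrow> (g \<longlongrightarrow> q) F \<Longrightarrow> p \<in> V \<Longrightarrow> q \<in> V \<Longrightarrow>
      eventually (\<lambda>n. causal_le l (f n) (g n)) F \<Longrightarrow> causal_le l p q"
proof -
  obtain U where U: "x \<in> interior U"
    "closedin (top_of_set (U \<times> U)) {(y, z). y \<in> U \<and> z \<in> U \<and> causal_le l y z}"
    using assms unfolding locally_causally_closed_def by blast
  then obtain T where T: "closed T" "{(y, z). y \<in> U \<and> z \<in> U \<and> causal_le l y z} = (U \<times> U) \<inter> T"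
    unfolding closedin_closed by blast
  have "causal_le l p q" if "F \<noteq> bot" "(f \<longlongrightarrow> p) F" "(g \<longlongrightarrow> q) F"
    "p \<in> interior U" "q \<in> interior U" "eventually (\<lambda>n. causal_le l (f n) (g n)) F"
    for p q and F :: "'b filter" and f g
  proof -
    have "eventually (\<lambda>n. f n \<in> interior U) F" "eventually (\<lambda>n. g n \<in> interior U) F"
      using that by (auto intro: topological_tendstoD)
    then have "eventually (\<lambda>n. (f n, g n) \<in> T) F"
      using that(6)
    proof eventually_elim
      case (elim n)
      then have "(f n, g n) \<in> (U \<times> U) \<inter> T"
        unfolding T(2)[symmetric] using interior_subset by blast
      then show ?case by blast
    qed
    then have "(p, q) \<in> T"
      using that T(1) by (intro Lim_in_closed_set[of T "\<lambda>n. (f n, g n)" F]) (auto intro: tendsto_Pair)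
    with that(4,5) interior_subset have "(p, q) \<in> (U \<times> U) \<inter> T" by blast
    then show ?thesis unfolding T(2)[symmetric] by blast
  qed
  with U(1) show thesis by (intro that[of "interior U"]) auto
qed

text \<open>A product of compact spaces is compact but need not be sequentially compact, so a
  cluster point is used in place of a subsequential limit. \<open>G\<close> is the infimum of its
  neighbourhood filter and the image of the sequence.\<close>

lemma pointwise_cluster_filter:
  fixes F :: "nat \<Rightarrow> 'b \<Rightarrow> 'a::topological_space"
  assumes "compact K" "\<And>n t. F n t \<in> K"
  obtains \<sigma> G where "G \<noteq> bot" "G \<le> filtermap F sequentially" "\<And>t. ((\<lambda>\<rho>. \<rho> t) \<longlongrightarrow> \<sigma> t) G"
proof -
  have "compactin (product_topology (\<lambda>_::'b. euclidean :: 'a topology) UNIV) (PiE UNIV (\<lambda>_. K))"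
    using assms(1) unfolding compactin_PiE by simp
  then have "compact (PiE UNIV (\<lambda>_::'b. K))"
    unfolding euclidean_product_topology by simp
  moreover have "filtermap F sequentially \<noteq> bot" by (simp add: filtermap_bot_iff)
  moreover have "eventually (\<lambda>\<rho>. \<rho> \<in> PiE UNIV (\<lambda>_. K)) (filtermap F sequentially)"
    using assms(2) by (simp add: eventually_filtermap PiE_UNIV_domain)
  ultimately obtain \<sigma> where \<sigma>: "inf (nhds \<sigma>) (filtermap F sequentially) \<noteq> bot"
    unfolding compact_filter by blast
  have "((\<lambda>\<rho>. \<rho> t) \<longlongrightarrow> \<sigma> t) (nhds \<sigma>)" for t
    using continuous_on_product_coordinates[of t] tendsto_at_iff_tendsto_nhds[of "\<lambda>\<rho>. \<rho> t" \<sigma>]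
    by (auto simp: continuous_on_def)
  then have "((\<lambda>\<rho>. \<rho> t) \<longlongrightarrow> \<sigma> t) (inf (nhds \<sigma>) (filtermap F sequentially))" for t
    by (meson inf_le1 tendsto_mono)
  with \<sigma> show thesis by (intro that) auto
qed

section \<open>Limit curves\<close>

text \<open>
  Only a pointwise cluster point of the curves is needed: the uniform Lipschitz constant supplies
  all the uniformity, and Tychonoff's theorem replaces that of Arzela and Ascoli.
\<close>

lemma limit_curve:
  fixes l :: "'a::metric_space \<Rightarrow> 'a \<Rightarrow> ereal"
  assumes ms: "metric_spacetime l" and nti: "non_totally_imprisoning l"
    and lcc: "locally_causally_closed l" and K: "compact K"
    and from_to: "\<And>n. causal_curve_from_to l (x n) (y n) (a n) (b n) (\<gamma> n)"
    and sub: "\<And>n. \<gamma> n ` {a n..b n} \<subseteq> K"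
    and lim: "x \<longlonglongrightarrow> p" "y \<longlonglongrightarrow> q"
  obtains C \<tau> \<sigma> G where "C \<ge> 0"
    "\<And>n. L_ell l 0 1 (\<tau> n) \<le> L_ell l (a n) (b n) (\<gamma> n)"
    "G \<noteq> bot" "G \<le> filtermap \<tau> sequentially" "\<And>t. ((\<lambda>\<rho>. \<rho> t) \<longlongrightarrow> \<sigma> t) G"
    "eventually (\<lambda>\<rho>. causal_path l {0..1} \<rho> \<and> C-lipschitz_on {0..1} \<rho>) G"
    "causal_path l {0..1} \<sigma>" "C-lipschitz_on {0..1} \<sigma>" "\<sigma> 0 = p" "\<sigma> 1 = q"
proof -
  have \<gamma>: "causal_curve l {a n..b n} (\<gamma> n)" "\<gamma> n (a n) = x n" "\<gamma> n (b n) = y n" for n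
    using from_to[of n] by (simp_all add: causal_curve_from_to_def)
  obtain C :: real where C_all:
    "\<forall>a b \<sigma>. causal_curve l {a..b} \<sigma> \<and> \<sigma> ` {a..b} \<subseteq> K \<longrightarrow> L_d a b \<sigma> \<le> ereal C"
    using nti[unfolded non_totally_imprisoning_def, rule_format, OF K] by (elim exE)
  then have C: "L_d (a n) (b n) (\<gamma> n) \<le> ereal C" for n
    using \<gamma>(1)[of n] sub[of n] by simp
  define Q where "Q n h \<longleftrightarrow> strict_mono_on {0..1} h \<and> h 0 = a n \<and> h 1 = b n \<and>
    range h \<subseteq> {a n..b n} \<and> (C + 1)-lipschitz_on {0..1} (\<gamma> n \<circ> h)" for n and h :: "real \<Rightarrow> real"
  have "\<exists>h. Q n h" for n
  proof -
    have ab: "a n < b n" using \<gamma>(1) by (rule causal_curve_less)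
    have "locally_lipschitz_on {a n..b n} (\<gamma> n)"
      using \<gamma>(1)[of n] by (simp add: causal_curve_def)
    from locally_lipschitz_on_interval_imp_lipschitz[OF this less_imp_le[OF ab]]
    obtain k where "k-lipschitz_on {a n..b n} (\<gamma> n)" .
    from bounded_length_reparametrization[OF ab this C] show ?thesis
      unfolding Q_def by metis
  qed
  then obtain h where "\<And>n. Q n (h n)" by metis
  then have h: "\<And>n. strict_mono_on {0..1} (h n)" "\<And>n. h n 0 = a n" "\<And>n. h n 1 = b n"
    "\<And>n. range (h n) \<subseteq> {a n..b n}" "\<And>n. (C + 1)-lipschitz_on {0..1} (\<gamma> n \<circ> h n)"
    unfolding Q_def by simp_all
  have h_in: "h n u \<in> {a n..b n}" for n u using h(4)[of n] by blast
  define \<tau> where "\<tau> n = \<gamma> n \<circ> h n" for n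
  have "\<tau> n t \<in> K" for n t
    using sub[of n] h_in[of n t] by (auto simp: \<tau>_def)
  from pointwise_cluster_filter[of K \<tau>, OF K this] obtain \<sigma> G where G: "G \<noteq> bot"
    "G \<le> filtermap \<tau> sequentially" "\<And>t. ((\<lambda>\<rho>. \<rho> t) \<longlongrightarrow> \<sigma> t) G"
    by blast
  have "causal_path l {0..1} (\<tau> n)" for n
    unfolding causal_path_def
  proof (intro conjI ballI impI)
    fix s t :: real assume "s \<in> {0..1}" "t \<in> {0..1}" "s < t"
    then have "h n s < h n t"
      using h(1)[of n] by (auto simp: strict_mono_on_def)
    then show "l (\<tau> n s) (\<tau> n t) \<le> 0"
      using \<gamma>(1)[of n] h_in[of n s] h_in[of n t]
      unfolding \<tau>_def causal_curve_def causal_path_def by auto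
  qed (simp add: is_interval_cc)
  \<comment> \<open>What holds for every \<open>\<tau> n\<close> holds eventually along
    \<open>G\<close>, which is finer than the image filter of \<tau>.\<close>
  then have ev: "eventually (\<lambda>\<rho>. causal_path l {0..1} \<rho> \<and> (C + 1)-lipschitz_on {0..1} \<rho>) G"
    using h(5) by (intro filter_leD[OF G(2)]) (auto simp: eventually_filtermap \<tau>_def)
  have C0: "C + 1 \<ge> 0" using h(5)[of 0] by (rule lipschitz_on_nonneg)
  have lip: "(C + 1)-lipschitz_on {0..1} \<sigma>"
  proof (rule lipschitz_onI[OF _ C0])
    fix s t :: real assume "s \<in> {0..1}" "t \<in> {0..1}"
    then have "eventually (\<lambda>\<rho>. dist (\<rho> s) (\<rho> t) \<le> (C + 1) * dist s t) G"
      using ev by (auto elim!: eventually_mono dest: lipschitz_onD)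
    then show "dist (\<sigma> s) (\<sigma> t) \<le> (C + 1) * dist s t"
      by (intro tendsto_upperbound[OF tendsto_dist[OF G(3)[of s] G(3)[of t]]]) (use G(1) in auto)
  qed
  have "causal_le l (\<sigma> s) (\<sigma> t)" if st: "0 \<le> s" "s \<le> t" "t \<le> 1" for s t
  proof -
    \<comment> \<open>Bisection again: the relation is transitive, and near each parameter
      \<open>x\<close> the continuous limit \<sigma> stays in a single neighbourhood in which the
      relation is closed.\<close>
    define P where "P c d \<longleftrightarrow> (s \<le> c \<and> c \<le> d \<and> d \<le> t \<longrightarrow> causal_le l (\<sigma> c) (\<sigma> d))" for c d
    have "P s t"
      using st(2)
    proof (induction rule: Bolzano)
      case (trans c d e)
      then show ?case
        unfolding P_def using causal_le_trans[OF ms, of "\<sigma> c" "\<sigma> d" "\<sigma> e"] by auto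
    next
      case (local x)
      obtain V where V: "open V" "\<sigma> x \<in> V"
        and V_closed: "\<And>(F :: (real \<Rightarrow> 'a) filter) f g p q. F \<noteq> bot \<Longrightarrow> (f \<longlongrightarrow> p) F \<Longrightarrow>
          (g \<longlongrightarrow> q) F \<Longrightarrow> p \<in> V \<Longrightarrow> q \<in> V \<Longrightarrow>
          eventually (\<lambda>n. causal_le l (f n) (g n)) F \<Longrightarrow> causal_le l p q"
        by (rule locally_causally_closed_limit[OF lcc]) (rule that)
      have "continuous_on {0..1} \<sigma>" using lip by (rule lipschitz_on_continuous_on)
      then have "(\<sigma> \<longlongrightarrow> \<sigma> x) (at x within {0..1})"
        using local st by (auto simp: continuous_on_def)
      from topological_tendstoD[OF this V(1,2)]
      obtain \<delta> where \<delta>: "\<delta> > 0" "\<And>y. y \<in> {0..1} \<Longrightarrow> dist y x < \<delta> \<Longrightarrow> \<sigma> y \<in> V"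
        using V(2) unfolding eventually_at by metis
      have "P c d" if "c \<le> x" "x \<le> d" "d - c < \<delta>" for c d
        unfolding P_def
      proof (intro impI V_closed[OF G(1) G(3)[of c] G(3)[of d]])
        assume "s \<le> c \<and> c \<le> d \<and> d \<le> t"
        then show "\<sigma> c \<in> V" "\<sigma> d \<in> V" "eventually (\<lambda>\<rho>. causal_le l (\<rho> c) (\<rho> d)) G"
          using \<delta>(2)[of c] \<delta>(2)[of d] st that ev
          by (auto simp: dist_real_def elim!: eventually_mono intro: causal_pathD[OF ms])
      qed
      with \<delta>(1) show ?case by blast
    qed
    with st show ?thesis by (simp add: P_def)
  qed
  then have "causal_path l {0..1} \<sigma>"
    by (auto simp: causal_path_def causal_le_def is_interval_cc)
  moreover have "L_ell l 0 1 (\<tau> n) \<le> L_ell l (a n) (b n) (\<gamma> n)" for n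
    using path_length_reparametrize[OF h(1)[of n], of l "\<gamma> n"] h(2,3) by (simp add: \<tau>_def)
  moreover have "\<sigma> 0 = p" "\<sigma> 1 = q"
  proof -
    \<comment> \<open>The end points converge along the whole sequence, hence along the finer filter
      \<open>G\<close>, where limits are unique.\<close>
    have "((\<lambda>\<rho>. \<rho> 0) \<longlongrightarrow> p) (filtermap \<tau> sequentially)" "((\<lambda>\<rho>. \<rho> 1) \<longlongrightarrow> q) (filtermap \<tau> sequentially)"
      using lim \<gamma>(2,3) h(2,3) by (simp_all add: filterlim_filtermap \<tau>_def)
    then have "((\<lambda>\<rho>. \<rho> 0) \<longlongrightarrow> p) G" "((\<lambda>\<rho>. \<rho> 1) \<longlongrightarrow> q) G"
      using G(2) by (auto intro: tendsto_mono)
    then show "\<sigma> 0 = p" "\<sigma> 1 = q"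
      using tendsto_unique[OF G(1) G(3)] by auto
  qed
  ultimately show thesis
    using C0 G ev lip by (intro that[of "C + 1" \<tau> G \<sigma>])
qed

section \<open>Upper semicontinuity of length\<close>

text \<open>Superadditivity along \<open>p \<le> p \<le> p\<close> gives
  \<open>2 * \<omega> p p \<le> \<omega> p p\<close>, so \<omega> is not positive there and
  \<open>p\<close> does not precede itself chronologically.\<close>

lemma local_time_separation_imp_l_refl:
  assumes "metric_spacetime l" "local_time_separation l \<Omega> \<omega>" "p \<in> \<Omega>"
  shows "l p p = 0"
proof -
  have "\<omega> p p \<ge> \<omega> p p + \<omega> p p"
    using assms metric_spacetime_refl[OF assms(1), of p]
    unfolding local_time_separation_def causal_le_def by blast
  then have "\<not> chron l p p"
    using assms(2,3) unfolding local_time_separation_def by (metis add_le_same_cancel1 not_le)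
  then show ?thesis
    using metric_spacetime_refl[OF assms(1), of p] by (simp add: chron_def)
qed

lemma localizable_imp_l_refl: "metric_spacetime l \<Longrightarrow> localizable l \<Longrightarrow> l p p = 0"
  unfolding localizable_def using local_time_separation_imp_l_refl by metis

lemma local_time_separation_nonneg:
  "local_time_separation l \<Omega> \<omega> \<Longrightarrow> p \<in> \<Omega> \<Longrightarrow> r \<in> \<Omega> \<Longrightarrow> 0 \<le> \<omega> p r"
  by (simp add: local_time_separation_def)

text \<open>A curve in \<Omega> competes with the maximizer between its end points, whose length is
  \<omega>. Maximizers exist only between distinct points; for a degenerate interval or a closed
  path the length is at most 0, the latter since \<open>l p p = 0\<close>.\<close>

lemma local_length_le_separation:
  assumes ms: "metric_spacetime l"
    and lts: "local_time_separation l \<Omega> \<omega>" and lm: "locally_maximizing l \<Omega> \<omega>"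
    and st: "s \<le> t" and \<rho>: "causal_path l {s..t} \<rho>" "K-lipschitz_on {s..t} \<rho>" "\<rho> ` {s..t} \<subseteq> \<Omega>"
  shows "- L_ell l s t \<rho> \<le> ereal (\<omega> (\<rho> s) (\<rho> t))"
proof -
  have in_\<Omega>: "\<rho> s \<in> \<Omega>" "\<rho> t \<in> \<Omega>" using \<rho>(3) st by auto
  consider "s = t" | "s < t" "\<rho> s = \<rho> t" | "s < t" "\<rho> s \<noteq> \<rho> t" using st by linarith
  then show ?thesis
  proof cases
    case 1
    then have "0 \<le> L_ell l s t \<rho>"
      using chain_sum_le_path_length[OF chain_sum.refl] by simp
    then have "- L_ell l s t \<rho> \<le> 0" by (simp add: ereal_uminus_le_0_iff)
    also have "0 \<le> ereal (\<omega> (\<rho> s) (\<rho> t))"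
      using local_time_separation_nonneg[OF lts in_\<Omega>] by simp
    finally show ?thesis .
  next
    case 2
    then have "0 \<le> L_ell l s t \<rho>"
      using le_path_length[of s t l \<rho>] local_time_separation_imp_l_refl[OF ms lts in_\<Omega>(1)] by simp
    then have "- L_ell l s t \<rho> \<le> 0" by (simp add: ereal_uminus_le_0_iff)
    also have "0 \<le> ereal (\<omega> (\<rho> s) (\<rho> t))"
      using local_time_separation_nonneg[OF lts in_\<Omega>] by simp
    finally show ?thesis .
  next
    case 3
    then have curve: "causal_curve_from_to l (\<rho> s) (\<rho> t) s t \<rho>"
      using \<rho> by (intro causal_curve_from_toI) auto
    with 3 have "causal_less l (\<rho> s) (\<rho> t)"
      using causal_curve_from_to_le[OF ms] by (simp add: causal_less_def)
    then obtain a b \<sigma> where "L_ell l a b \<sigma> \<le> L_ell l s t \<rho>" "- L_ell l a b \<sigma> = ereal (\<omega> (\<rho> s) (\<rho> t))"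
      using lm in_\<Omega> curve \<rho>(3) unfolding locally_maximizing_def by meson
    then show ?thesis by (metis ereal_minus_le_minus)
  qed
qed

text \<open>For causally related distinct points the bound is part of the maximizing property. All
  other pairs are not chronologically related, so \<omega> vanishes on them.\<close>

lemma local_separation_le_ell_minus:
  assumes ms: "metric_spacetime l"
    and lts: "local_time_separation l \<Omega> \<omega>" and lm: "locally_maximizing l \<Omega> \<omega>"
    and "p \<in> \<Omega>" "r \<in> \<Omega>"
  shows "ereal (\<omega> p r) \<le> ell_minus l p r"
proof (cases "causal_less l p r")
  case True
  then show ?thesis using lm assms(4,5) unfolding locally_maximizing_def by meson
next
  case False
  have "\<not> chron l p r"
    using False local_time_separation_imp_l_refl[OF ms lts assms(4)] chron_imp_causal_le[of l p r]
    by (auto simp: causal_less_def chron_def)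
  then have "\<not> 0 < \<omega> p r" using lts assms(4,5) unfolding local_time_separation_def by blast
  then show ?thesis using ell_minus_nonneg[of l p r]
    by (auto simp: not_less zero_ereal_def intro: order_trans[of _ "ereal 0"])
qed

text \<open>The limit superior along \<open>G\<close> of the lengths over \<open>{s..t}\<close> is
  at most \<open>B\<close>. Taking \<open>B\<close> real records finiteness at the same
  time.\<close>

definition asymptotic_length_bound ::
    "('a \<Rightarrow> 'a \<Rightarrow> ereal) \<Rightarrow> (real \<Rightarrow> 'a) filter \<Rightarrow> real \<Rightarrow> real \<Rightarrow> real \<Rightarrow> bool" where
  "asymptotic_length_bound l G s t B \<longleftrightarrow>
     (\<forall>e>0. eventually (\<lambda>\<rho>. - L_ell l s t \<rho> \<le> ereal (B + e)) G)"

text \<open>Superadditivity of \<open>L_ell\<close> makes the length \<open>- L_ell\<close>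
  subadditive over adjacent intervals; each gets half of the error.\<close>

lemma asymptotic_length_bound_add:
  assumes ev: "eventually (\<lambda>\<rho>. causal_path l {a..b} \<rho>) G"
    and cde: "a \<le> c" "c \<le> d" "d \<le> e" "e \<le> b"
    and "asymptotic_length_bound l G c d B" "asymptotic_length_bound l G d e B'"
  shows "asymptotic_length_bound l G c e (B + B')"
  unfolding asymptotic_length_bound_def
proof (intro allI impI)
  fix \<epsilon> :: real assume "\<epsilon> > 0"
  then have "eventually (\<lambda>\<rho>. - L_ell l c d \<rho> \<le> ereal (B + \<epsilon> / 2)) G"
    "eventually (\<lambda>\<rho>. - L_ell l d e \<rho> \<le> ereal (B' + \<epsilon> / 2)) G"
    using assms(6,7) unfolding asymptotic_length_bound_def by simp_all
  with ev show "eventually (\<lambda>\<rho>. - L_ell l c e \<rho> \<le> ereal (B + B' + \<epsilon>)) G"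
  proof eventually_elim
    case (elim \<rho>)
    have "L_ell l c d \<rho> \<le> 0" "L_ell l d e \<rho> \<le> 0"
      using cde elim(1) by (auto intro!: L_ell_nonpos intro: causal_path_subinterval)
    moreover from path_length_superadditive[OF cde(2,3) this]
    have "L_ell l c d \<rho> + L_ell l d e \<rho> \<le> L_ell l c e \<rho>" .
    ultimately show ?case
      using elim(2,3)
      by (cases "L_ell l c d \<rho>"; cases "L_ell l d e \<rho>"; cases "L_ell l c e \<rho>") auto
  qed
qed

text \<open>
  Upper semicontinuity of length. It holds on short intervals because a local time separation is
  continuous, and it is additive, so bisection extends it to the whole curve.
\<close>

lemma limit_length_bound:
  assumes ms: "metric_spacetime l" and loc: "localizable l" and C: "C \<ge> 0"
    and G: "\<And>t. ((\<lambda>\<rho>. \<rho> t) \<longlongrightarrow> \<sigma> t) G"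
    and ev: "eventually (\<lambda>\<rho>. causal_path l {0..1} \<rho> \<and> C-lipschitz_on {0..1} \<rho>) G"
    and \<sigma>: "causal_path l {0..1} \<sigma>" "C-lipschitz_on {0..1} \<sigma>"
    and st: "0 \<le> s" "s \<le> t" "t \<le> 1"
  shows "\<exists>B. ereal B \<le> ell_minus l (\<sigma> s) (\<sigma> t) \<and> asymptotic_length_bound l G s t B"
proof -
  define P where "P c d \<longleftrightarrow> (s \<le> c \<and> c \<le> d \<and> d \<le> t \<longrightarrow>
    (\<exists>B. ereal B \<le> ell_minus l (\<sigma> c) (\<sigma> d) \<and> asymptotic_length_bound l G c d B))" for c d
  have "P s t"
    using st(2)
  proof (induction rule: Bolzano)
    case (trans c d e)
    show ?case
      unfolding P_def
    proof
      assume e: "s \<le> c \<and> c \<le> e \<and> e \<le> t"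
      obtain B where B: "ereal B \<le> ell_minus l (\<sigma> c) (\<sigma> d)" "asymptotic_length_bound l G c d B"
        using trans e unfolding P_def by auto
      obtain B' where B': "ereal B' \<le> ell_minus l (\<sigma> d) (\<sigma> e)" "asymptotic_length_bound l G d e B'"
        using trans e unfolding P_def by auto
      have "causal_le l (\<sigma> c) (\<sigma> d)" "causal_le l (\<sigma> d) (\<sigma> e)"
        using causal_pathD[OF ms \<sigma>(1)] trans(3,4) e st by auto
      from ell_minus_triangle[OF ms this] have "ereal (B + B') \<le> ell_minus l (\<sigma> c) (\<sigma> e)"
        using add_mono[OF B(1) B'(1)] by (simp flip: plus_ereal.simps(1))
      moreover have "asymptotic_length_bound l G c e (B + B')"
        using trans(3,4) e st ev B(2) B'(2)
        by (intro asymptotic_length_bound_add[of l 0 1 G c d e]) (auto elim: eventually_mono)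
      ultimately show "\<exists>B. ereal B \<le> ell_minus l (\<sigma> c) (\<sigma> e) \<and> asymptotic_length_bound l G c e B"
        by blast
    qed
  next
    case (local x)
    obtain \<Omega> \<omega> where \<Omega>: "open \<Omega>" "\<sigma> x \<in> \<Omega>" "local_time_separation l \<Omega> \<omega>" "locally_maximizing l \<Omega> \<omega>"
      using loc unfolding localizable_def by metis
    obtain r where r: "r > 0" "ball (\<sigma> x) r \<subseteq> \<Omega>"
      using \<Omega>(1,2) open_contains_ball by blast
    \<comment> \<open>One half of \<open>r\<close> allows for the distance of
      \<open>\<rho> x\<close> from \<open>\<sigma> x\<close>, the other for the motion of a
      \<open>C\<close>-Lipschitz curve within time \<delta>. The 1 keeps the denominator positive
      when \<open>C = 0\<close>.\<close>
    define \<delta> where "\<delta> = r / (2 * (C + 1))"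
    have \<delta>: "\<delta> > 0" using r(1) C by (simp add: \<delta>_def)
    have C\<delta>: "C * v < r / 2" if "0 \<le> v" "v < \<delta>" for v
    proof -
      have "C * v \<le> (C + 1) * v" using that by (simp add: mult_right_mono)
      also have "\<dots> < (C + 1) * \<delta>" using that C by simp
      also have "\<dots> = r / 2" using C by (simp add: \<delta>_def divide_simps)
      finally show ?thesis .
    qed
    have near: "\<rho> u \<in> \<Omega>"
      if "C-lipschitz_on {0..1} \<rho>" "dist (\<rho> x) (\<sigma> x) < r / 2" "u \<in> {0..1}" "\<bar>u - x\<bar> < \<delta>" for \<rho> u
    proof -
      have "dist (\<rho> u) (\<rho> x) \<le> C * \<bar>u - x\<bar>"
        using lipschitz_onD[OF that(1), of u x] that(3) local st by (simp add: dist_real_def)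
      also have "\<dots> < r / 2" using C\<delta>[of "\<bar>u - x\<bar>"] that(4) by simp
      finally have "dist (\<sigma> x) (\<rho> u) < r"
        using that(2) dist_triangle[of "\<sigma> x" "\<rho> u" "\<rho> x"] by (simp add: dist_commute)
      with r(2) show ?thesis by auto
    qed
    have "P c d" if cd: "c \<le> x" "x \<le> d" "d - c < \<delta>" for c d
      unfolding P_def
    proof
      assume scdt: "s \<le> c \<and> c \<le> d \<and> d \<le> t"
      have \<sigma>_in: "\<sigma> c \<in> \<Omega>" "\<sigma> d \<in> \<Omega>"
        using near[OF \<sigma>(2), of c] near[OF \<sigma>(2), of d] r(1) scdt cd st by auto
      have "eventually (\<lambda>\<rho>. dist (\<rho> x) (\<sigma> x) < r / 2) G"
        using tendstoD[OF G[of x], of "r / 2"] r(1) by simp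
      \<comment> \<open>Closeness at the single parameter \<open>x\<close> keeps the whole segment
        over \<open>{c..d}\<close> in \<Omega>, thanks to the common Lipschitz constant.\<close>
      with ev have len: "eventually (\<lambda>\<rho>. - L_ell l c d \<rho> \<le> ereal (\<omega> (\<rho> c) (\<rho> d))) G"
      proof eventually_elim
        case (elim \<rho>)
        have "\<rho> ` {c..d} \<subseteq> \<Omega>"
        proof safe
          fix u assume "u \<in> {c..d}"
          then show "\<rho> u \<in> \<Omega>" using near[of \<rho> u] elim scdt cd st by auto
        qed
        then show ?case
          using elim scdt st
          by (intro local_length_le_separation[OF ms \<Omega>(3,4)])
            (auto intro: causal_path_subinterval lipschitz_on_subset)
      qed
      have "continuous_on (\<Omega> \<times> \<Omega>) (\<lambda>(p, r). \<omega> p r)"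
        using \<Omega>(3) by (simp add: local_time_separation_def)
      then have "isCont (\<lambda>(p, r). \<omega> p r) (\<sigma> c, \<sigma> d)"
        using \<Omega>(1) \<sigma>_in by (simp add: continuous_on_eq_continuous_at open_Times)
      from isCont_tendsto_compose[OF this tendsto_Pair[OF G[of c] G[of d]]]
      have \<omega>_lim: "((\<lambda>\<rho>. \<omega> (\<rho> c) (\<rho> d)) \<longlongrightarrow> \<omega> (\<sigma> c) (\<sigma> d)) G" by simp
      \<comment> \<open>The bound sought is the local separation of the end points of the limit
        segment, approached by continuity of \<omega>.\<close>
      have "asymptotic_length_bound l G c d (\<omega> (\<sigma> c) (\<sigma> d))"
        unfolding asymptotic_length_bound_def
      proof (intro allI impI)
        fix e :: real assume "e > 0"
        then have "eventually (\<lambda>\<rho>. \<omega> (\<rho> c) (\<rho> d) < \<omega> (\<sigma> c) (\<sigma> d) + e) G"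
          using order_tendstoD(2)[OF \<omega>_lim] by simp
        with len show "eventually (\<lambda>\<rho>. - L_ell l c d \<rho> \<le> ereal (\<omega> (\<sigma> c) (\<sigma> d) + e)) G"
          by eventually_elim (auto intro: order_trans)
      qed
      then show "\<exists>B. ereal B \<le> ell_minus l (\<sigma> c) (\<sigma> d) \<and> asymptotic_length_bound l G c d B"
        using local_separation_le_ell_minus[OF ms \<Omega>(3,4) \<sigma>_in] by blast
    qed
    with \<delta> show ?case by blast
  qed
  with st show ?thesis by (simp add: P_def)
qed

text \<open>Lengths do not drop in the limit: each partition of the limit curve yields an asymptotic
  bound on the lengths of the approximating curves, and \<open>- L_ell\<close> is the infimum over
  partitions.\<close>

lemma limit_length:
  fixes l :: "'a::metric_space \<Rightarrow> 'a \<Rightarrow> ereal"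
  assumes ms: "metric_spacetime l" and nti: "non_totally_imprisoning l"
    and lcc: "locally_causally_closed l" and loc: "localizable l" and K: "compact K"
    and from_to: "\<And>n. causal_curve_from_to l (x n) (y n) (a n) (b n) (\<gamma> n)"
    and sub: "\<And>n. \<gamma> n ` {a n..b n} \<subseteq> K"
    and lim: "x \<longlonglongrightarrow> p" "y \<longlonglongrightarrow> q"
    and len: "\<And>n. c n \<le> - L_ell l (a n) (b n) (\<gamma> n)" "c \<longlonglongrightarrow> c'"
  shows "c' \<noteq> \<infinity> \<and> (\<exists>\<sigma> C. causal_path l {0..1} \<sigma> \<and> C-lipschitz_on {0..1} \<sigma> \<and>
    \<sigma> 0 = p \<and> \<sigma> 1 = q \<and> c' \<le> - L_ell l 0 1 \<sigma>)"
proof -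
  obtain C \<tau> \<sigma> G where C: "C \<ge> 0"
    and \<tau>: "\<And>n. L_ell l 0 1 (\<tau> n) \<le> L_ell l (a n) (b n) (\<gamma> n)"
    and G: "G \<noteq> bot" "G \<le> filtermap \<tau> sequentially" "\<And>t. ((\<lambda>\<rho>. \<rho> t) \<longlongrightarrow> \<sigma> t) G"
    and ev: "eventually (\<lambda>\<rho>. causal_path l {0..1} \<rho> \<and> C-lipschitz_on {0..1} \<rho>) G"
    and \<sigma>: "causal_path l {0..1} \<sigma>" "C-lipschitz_on {0..1} \<sigma>" "\<sigma> 0 = p" "\<sigma> 1 = q"
    by (rule limit_curve[OF ms nti lcc K from_to sub lim]) (rule that)
  \<comment> \<open>Adding the bounds for the links of a chain bounds the approximating lengths by
    its sum \<open>- v\<close>.\<close>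
  have chain: "t \<le> 1 \<longrightarrow> (\<exists>B. ereal B \<le> - v \<and> asymptotic_length_bound l G 0 t B)"
    if "chain_sum l \<sigma> 0 t v" for t v
    using that
  proof (induction rule: chain_sum.induct)
    case refl
    have "- L_ell l 0 0 \<rho> \<le> 0" for \<rho>
      using chain_sum_le_path_length[OF chain_sum.refl[of l \<rho> 0]]
      by (simp add: ereal_uminus_le_0_iff)
    then have "asymptotic_length_bound l G 0 0 0"
      unfolding asymptotic_length_bound_def
    proof (intro allI impI always_eventually)
      fix e :: real and \<rho> assume "e > 0"
      then have "0 \<le> ereal (0 + e)" by simp
      with \<open>- L_ell l 0 0 \<rho> \<le> 0\<close> show "- L_ell l 0 0 \<rho> \<le> ereal (0 + e)"
        by (rule order_trans)
    qed
    then show ?case by (auto simp: zero_ereal_def intro!: exI[of _ 0])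
  next
    case (step d v t)
    show ?case
    proof
      assume t: "t \<le> 1"
      then obtain B where B: "ereal B \<le> - v" "asymptotic_length_bound l G 0 d B"
        using step by auto
      have d: "0 \<le> d" using step.hyps(1) by (rule chain_sum_imp_le)
      obtain B' where B': "ereal B' \<le> ell_minus l (\<sigma> d) (\<sigma> t)" "asymptotic_length_bound l G d t B'"
        using limit_length_bound[OF ms loc C G(3) ev \<sigma>(1,2) d, of t] step.hyps(2) t by auto
      have "causal_le l (\<sigma> d) (\<sigma> t)"
        using causal_pathD[OF ms \<sigma>(1) d] step.hyps(2) t by simp
      then have "ereal B' \<le> - l (\<sigma> d) (\<sigma> t)" using B'(1) by (simp add: ell_minus_causal)
      with B(1) have "ereal (B + B') \<le> - (v + l (\<sigma> d) (\<sigma> t))"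
        by (cases v; cases "l (\<sigma> d) (\<sigma> t)") auto
      moreover have "asymptotic_length_bound l G 0 t (B + B')"
        using step.hyps(2) d t ev B(2) B'(2)
        by (intro asymptotic_length_bound_add[of l 0 1 G 0 d t]) (auto elim: eventually_mono)
      ultimately show "\<exists>B. ereal B \<le> - (v + l (\<sigma> d) (\<sigma> t)) \<and> asymptotic_length_bound l G 0 t B"
        by blast
    qed
  qed
  \<comment> \<open>If \<open>c'\<close> exceeded \<open>B + e\<close>, then so would the lengths of
    almost all \<open>\<tau> n\<close>, hence the lengths along \<open>G\<close>, against the
    asymptotic bound since \<open>G\<close> is proper.\<close>
  have c'_le: "c' \<le> ereal B" if B: "asymptotic_length_bound l G 0 1 B" for B
  proof (rule ereal_le_epsilon2)
    fix e :: real assume e: "0 < e"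
    show "c' \<le> ereal B + ereal e"
    proof (rule ccontr)
      assume "\<not> c' \<le> ereal B + ereal e"
      then have "eventually (\<lambda>n. ereal (B + e) < c n) sequentially"
        using order_tendstoD(1)[OF len(2)] by simp
      then have "eventually (\<lambda>n. ereal (B + e) < - L_ell l 0 1 (\<tau> n)) sequentially"
      proof eventually_elim
        case (elim n)
        have "c n \<le> - L_ell l 0 1 (\<tau> n)"
          using len(1)[of n] \<tau>[of n] by (metis ereal_minus_le_minus order_trans)
        with elim show ?case by (rule less_le_trans)
      qed
      then have "eventually (\<lambda>\<rho>. ereal (B + e) < - L_ell l 0 1 \<rho>) G"
        by (intro filter_leD[OF G(2)]) (simp add: eventually_filtermap)
      moreover have "eventually (\<lambda>\<rho>. - L_ell l 0 1 \<rho> \<le> ereal (B + e)) G"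
        using B e by (simp add: asymptotic_length_bound_def)
      ultimately have "eventually (\<lambda>\<rho>. False) G"
        by eventually_elim simp
      then show False using G(1) by (simp add: eventually_False)
    qed
  qed
  \<comment> \<open>The bound \<open>B\<close> is real, so a single chain already excludes
    \<open>c' = \<infinity>\<close>.\<close>
  have c'_chain: "c' \<noteq> \<infinity> \<and> v \<le> - c'" if v: "chain_sum l \<sigma> 0 1 v" for v
  proof -
    obtain B where B: "ereal B \<le> - v" "asymptotic_length_bound l G 0 1 B"
      using chain[OF v] by auto
    from c'_le[OF B(2)] B(1) show ?thesis
      by (cases c'; cases v) auto
  qed
  have "L_ell l 0 1 \<sigma> \<le> - c'"
    using c'_chain by (intro path_length_le) blast
  then have "c' \<le> - L_ell l 0 1 \<sigma>"
    using ereal_minus_le_minus[of "- c'" "L_ell l 0 1 \<sigma>"] by simp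
  moreover have "c' \<noteq> \<infinity>" using c'_chain[OF chain_sum_single[of 0 1]] by simp
  ultimately show ?thesis using \<sigma> by blast
qed

section \<open>Geodesics and continuity in Lorentzian length spaces\<close>

text \<open>The chronological relation is the positivity set of a lower semicontinuous function;
  futures and pasts are its slices.\<close>

lemma prelength_open_chron:
  assumes "lorentzian_prelength_space l"
  shows "open (chron_future l u)" "open (chron_past l u)"
proof -
  have "open {p. 0 < (case p of (x, y) \<Rightarrow> ell_minus l x y)}"
    using assms unfolding lorentzian_prelength_space_def lower_semicontinuous_def by blast
  then have *: "open {p. chron l (fst p) (snd p)}"
    by (simp add: case_prod_unfold ell_minus_pos_iff)
  have "open (Pair u -` {p. chron l (fst p) (snd p)})"
    by (intro open_vimage[OF *] continuous_intros)
  then show "open (chron_future l u)" by (simp add: chron_future_def vimage_def)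
  have "open ((\<lambda>x. (x, u)) -` {p. chron l (fst p) (snd p)})"
    by (intro open_vimage[OF *] continuous_intros)
  then show "open (chron_past l u)" by (simp add: chron_past_def vimage_def)
qed

lemma localizable_chron_nonempty:
  assumes "localizable l"
  shows "chron_future l x \<noteq> {}" "chron_past l x \<noteq> {}"
proof -
  obtain \<Omega> \<omega> where "x \<in> \<Omega>" "local_time_separation l \<Omega> \<omega>"
    using assms unfolding localizable_def by metis
  then show "chron_future l x \<noteq> {}" "chron_past l x \<noteq> {}"
    unfolding local_time_separation_def by blast+
qed

text \<open>Pick \<open>u\<close> in the past of \<open>p\<close> and \<open>w\<close> in the future
  of \<open>q\<close>. Openness puts \<open>x n\<close> after \<open>u\<close> and
  \<open>y n\<close> before \<open>w\<close> eventually, so the diamond from \<open>u\<close> to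
  \<open>w\<close> catches all curves between them.\<close>

lemma curves_eventually_in_compact:
  fixes l :: "'a::metric_space \<Rightarrow> 'a \<Rightarrow> ereal"
  assumes ms: "metric_spacetime l" and gh: "globally_hyperbolic l"
    and pre: "lorentzian_prelength_space l" and loc: "localizable l"
    and lim: "x \<longlonglongrightarrow> p" "y \<longlonglongrightarrow> q"
  obtains K where "compact K"
    "eventually (\<lambda>n. \<forall>a b \<gamma>. causal_curve_from_to l (x n) (y n) a b \<gamma> \<longrightarrow> \<gamma> ` {a..b} \<subseteq> K) sequentially"
proof -
  obtain u w where uw: "chron l u p" "chron l q w"
    using localizable_chron_nonempty(1)[OF loc, of q] localizable_chron_nonempty(2)[OF loc, of p]
    by (auto simp: chron_future_def chron_past_def)
  have "p \<in> chron_future l u" "q \<in> chron_past l w"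
    using uw by (simp_all add: chron_future_def chron_past_def)
  then have "eventually (\<lambda>n. x n \<in> chron_future l u) sequentially"
    "eventually (\<lambda>n. y n \<in> chron_past l w) sequentially"
    using topological_tendstoD[OF lim(1) prelength_open_chron(1)[OF pre]]
      topological_tendstoD[OF lim(2) prelength_open_chron(2)[OF pre]] by blast+
  then have "eventually (\<lambda>n. \<forall>a b \<gamma>. causal_curve_from_to l (x n) (y n) a b \<gamma> \<longrightarrow>
      \<gamma> ` {a..b} \<subseteq> causal_diamond l u w) sequentially"
  proof eventually_elim
    case (elim n)
    then show ?case
      using causal_curve_diamond[OF ms, of "x n" "y n" _ _ _ u w]
      by (simp add: chron_future_def chron_past_def chron_imp_causal_le)
  qed
  moreover have "compact (causal_diamond l u w)"
    using gh by (simp add: globally_hyperbolic_def)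
  ultimately show thesis using that by blast
qed

lemma globally_hyperbolic_causal_le_closed:
  fixes l :: "'a::metric_space \<Rightarrow> 'a \<Rightarrow> ereal"
  assumes ms: "metric_spacetime l" and gh: "globally_hyperbolic l"
    and lls: "lorentzian_length_space l"
  shows "closed {(x, y). causal_le l x y}"
  unfolding closed_sequential_limits
proof (intro allI impI, elim conjE)
  fix z :: "nat \<Rightarrow> 'a \<times> 'a" and pq
  assume z: "\<forall>n. z n \<in> {(x, y). causal_le l x y}" and z_lim: "z \<longlonglongrightarrow> pq"
  define x y p q
    where "x = (\<lambda>n. fst (z n))" and "y = (\<lambda>n. snd (z n))" and "p = fst pq" and "q = snd pq"
  have xy: "causal_le l (x n) (y n)" for n
    using z by (auto simp: x_def y_def case_prod_unfold)
  have lim: "x \<longlonglongrightarrow> p" "y \<longlonglongrightarrow> q"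
    using tendsto_fst[OF z_lim] tendsto_snd[OF z_lim] by (simp_all add: x_def y_def p_def q_def)
  have "causal_le l p q"
  proof (cases "p = q")
    case True
    then show ?thesis using metric_spacetime_refl[OF ms] by (simp add: causal_le_def)
  next
    case False
    have spaces: "lorentzian_prelength_space l" "localizable l" "locally_causally_closed l"
      "causally_curve_connected l"
      using lls by (simp_all add: lorentzian_length_space_def)
    have nti: "non_totally_imprisoning l" using gh by (simp add: globally_hyperbolic_def)
    obtain K where K: "compact K"
      "eventually (\<lambda>n. \<forall>a b \<gamma>. causal_curve_from_to l (x n) (y n) a b \<gamma> \<longrightarrow> \<gamma> ` {a..b} \<subseteq> K) sequentially"
      by (rule curves_eventually_in_compact[OF ms gh spaces(1,2) lim])
    \<comment> \<open>Curve-connectedness concerns distinct points. As \<open>p \<noteq> q\<close>,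
      the points \<open>x n\<close> and \<open>y n\<close> differ eventually, and a shift by
      \<open>N\<close> makes this hold at every index.\<close>
    have "eventually (\<lambda>n. 0 < dist (x n) (y n)) sequentially"
      using order_tendstoD(1)[OF tendsto_dist[OF lim], of 0] False by simp
    with K(2) have "eventually (\<lambda>n. x n \<noteq> y n \<and>
        (\<forall>a b \<gamma>. causal_curve_from_to l (x n) (y n) a b \<gamma> \<longrightarrow> \<gamma> ` {a..b} \<subseteq> K)) sequentially"
      by eventually_elim auto
    then obtain N where N: "\<And>n. n \<ge> N \<Longrightarrow> x n \<noteq> y n \<and>
        (\<forall>a b \<gamma>. causal_curve_from_to l (x n) (y n) a b \<gamma> \<longrightarrow> \<gamma> ` {a..b} \<subseteq> K)"
      unfolding eventually_sequentially by blast
    have "\<exists>a b \<gamma>. causal_curve_from_to l (x (n + N)) (y (n + N)) a b \<gamma>" for n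
      using spaces(4) xy N[of "n + N"] unfolding causally_curve_connected_def by simp
    then obtain a b \<gamma> where
      \<gamma>: "\<And>n. causal_curve_from_to l (x (n + N)) (y (n + N)) (a n) (b n) (\<gamma> n)"
      by metis
    have sub: "\<gamma> n ` {a n..b n} \<subseteq> K" for n
      using N[of "n + N"] \<gamma>[of n] by (meson le_add2)
    obtain \<sigma> where "causal_path l {0..1} \<sigma>" "\<sigma> 0 = p" "\<sigma> 1 = q"
      by (rule limit_curve[OF ms nti spaces(3) K(1) \<gamma> sub
            LIMSEQ_ignore_initial_segment[OF lim(1)] LIMSEQ_ignore_initial_segment[OF lim(2)]])
        (rule that)
    then show ?thesis using causal_pathD[OF ms, of 0 1 \<sigma> 0 1] by simp
  qed
  then show "pq \<in> {(x, y). causal_le l x y}" by (simp add: p_def q_def case_prod_unfold)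
qed

text \<open>The limit of a length-maximizing sequence in the compact diamond from \<open>p\<close>
  to \<open>q\<close> attains the supremum that equals \<open>ell_minus\<close>, and that supremum
  is finite.\<close>

lemma chron_imp_maximal_curve:
  fixes l :: "'a::metric_space \<Rightarrow> 'a \<Rightarrow> ereal"
  assumes ms: "metric_spacetime l" and gh: "globally_hyperbolic l"
    and lls: "lorentzian_length_space l" and chron: "chron l p q"
  shows "ell_minus l p q \<noteq> \<infinity>"
    "\<exists>\<sigma>. causal_curve_from_to l p q 0 1 \<sigma> \<and> L_ell l 0 1 \<sigma> = l p q"
proof -
  have spaces: "lorentzian_prelength_space l" "localizable l" "locally_causally_closed l"
    using lls by (simp_all add: lorentzian_length_space_def)
  have nti: "non_totally_imprisoning l" using gh by (simp add: globally_hyperbolic_def)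
  let ?S = "{- L_ell l a b \<sigma> | a b \<sigma>. causal_curve_from_to l p q a b \<sigma>}"
  have "ell_minus l p q = curve_separation l p q"
    using lls by (simp add: lorentzian_length_space_def)
  \<comment> \<open>Positivity of \<open>ell_minus\<close> rules out the default value 0 of
    \<open>curve_separation\<close>, so there are curves to choose from.\<close>
  with chron have S: "ell_minus l p q = Sup ?S" "?S \<noteq> {}"
    using ell_minus_pos_iff[of l p q] by (auto simp: curve_separation_def split: if_splits)
  obtain c where c: "incseq c" "range c \<subseteq> ?S" "Sup ?S = (SUP n. c n)"
    using Sup_countable_SUP[OF S(2)] by blast
  have c_lim: "c \<longlonglongrightarrow> ell_minus l p q"
    using LIMSEQ_SUP[OF c(1)] S(1) c(3) by simp
  have "\<exists>a b \<gamma>. causal_curve_from_to l p q a b \<gamma> \<and> c n = - L_ell l a b \<gamma>" for n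
    using c(2) by blast
  then obtain a b \<gamma> where \<gamma>: "\<And>n. causal_curve_from_to l p q (a n) (b n) (\<gamma> n)"
    "\<And>n. c n = - L_ell l (a n) (b n) (\<gamma> n)"
    by metis
  have K: "compact (causal_diamond l p q)"
    using gh by (simp add: globally_hyperbolic_def)
  have sub: "\<gamma> n ` {a n..b n} \<subseteq> causal_diamond l p q" for n
    using metric_spacetime_refl[OF ms]
    by (intro causal_curve_diamond[OF ms \<gamma>(1)]) (simp_all add: causal_le_def)
  have "ell_minus l p q \<noteq> \<infinity> \<and> (\<exists>\<sigma> C. causal_path l {0..1} \<sigma> \<and> C-lipschitz_on {0..1} \<sigma> \<and>
      \<sigma> 0 = p \<and> \<sigma> 1 = q \<and> ell_minus l p q \<le> - L_ell l 0 1 \<sigma>)"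
    using limit_length[where x = "\<lambda>_. p" and y = "\<lambda>_. q" and a = a and b = b and \<gamma> = \<gamma>,
        OF ms nti spaces(3,2) K \<gamma>(1) sub tendsto_const tendsto_const eq_refl[OF \<gamma>(2)] c_lim] .
  then obtain \<sigma> C where fin: "ell_minus l p q \<noteq> \<infinity>" and
    \<sigma>: "causal_path l {0..1} \<sigma>" "C-lipschitz_on {0..1} \<sigma>" "\<sigma> 0 = p" "\<sigma> 1 = q"
    "ell_minus l p q \<le> - L_ell l 0 1 \<sigma>" by blast
  show "ell_minus l p q \<noteq> \<infinity>" by (rule fin)
  have "p \<noteq> q" using chron localizable_imp_l_refl[OF ms spaces(2)] by (auto simp: chron_def)
  then have curve: "causal_curve_from_to l p q 0 1 \<sigma>"
    using \<sigma> by (intro causal_curve_from_toI) auto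
  have "L_ell l 0 1 \<sigma> \<le> l p q"
    using \<sigma>(5) chron by (simp add: ell_minus_causal chron_imp_causal_le)
  with causal_curve_L_ell_bounds(1)[OF curve] curve
  show "\<exists>\<sigma>. causal_curve_from_to l p q 0 1 \<sigma> \<and> L_ell l 0 1 \<sigma> = l p q" by auto
qed

text \<open>This is upper semicontinuity. For \<open>c > 0\<close> the approximating pairs are
  joined by maximal curves of length at least \<open>c\<close>, and the length of a limit curve
  bounds the separation of its end points from below.\<close>

lemma ell_minus_upper_level_closed:
  fixes l :: "'a::metric_space \<Rightarrow> 'a \<Rightarrow> ereal"
  assumes ms: "metric_spacetime l" and gh: "globally_hyperbolic l"
    and lls: "lorentzian_length_space l"
  shows "closed {(x, y). c \<le> ell_minus l x y}"
proof (cases "0 < c")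
  case False
  then have "{(x, y). c \<le> ell_minus l x y} = UNIV"
    using order_trans[OF _ ell_minus_nonneg, of c l] by (auto simp: not_less)
  then show ?thesis by simp
next
  case c: True
  have spaces: "lorentzian_prelength_space l" "localizable l" "locally_causally_closed l"
    using lls by (simp_all add: lorentzian_length_space_def)
  have nti: "non_totally_imprisoning l" using gh by (simp add: globally_hyperbolic_def)
  show ?thesis
    unfolding closed_sequential_limits
  proof (intro allI impI, elim conjE)
    fix z :: "nat \<Rightarrow> 'a \<times> 'a" and pq
    assume z: "\<forall>n. z n \<in> {(x, y). c \<le> ell_minus l x y}" and z_lim: "z \<longlonglongrightarrow> pq"
    define x y p q
    where "x = (\<lambda>n. fst (z n))" and "y = (\<lambda>n. snd (z n))" and "p = fst pq" and "q = snd pq"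
    have xy: "c \<le> ell_minus l (x n) (y n)" for n
      using z by (auto simp: x_def y_def case_prod_unfold)
    then have chron: "chron l (x n) (y n)" for n
      using c less_le_trans[OF c xy[of n]] by (simp add: ell_minus_pos_iff)
    have lim: "x \<longlonglongrightarrow> p" "y \<longlonglongrightarrow> q"
      using tendsto_fst[OF z_lim] tendsto_snd[OF z_lim] by (simp_all add: x_def y_def p_def q_def)
    obtain K where K: "compact K"
      "eventually (\<lambda>n. \<forall>a b \<gamma>. causal_curve_from_to l (x n) (y n) a b \<gamma> \<longrightarrow> \<gamma> ` {a..b} \<subseteq> K) sequentially"
      by (rule curves_eventually_in_compact[OF ms gh spaces(1,2) lim])
    then obtain N where N: "\<And>n. n \<ge> N \<Longrightarrow>
        \<forall>a b \<gamma>. causal_curve_from_to l (x n) (y n) a b \<gamma> \<longrightarrow> \<gamma> ` {a..b} \<subseteq> K"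
      unfolding eventually_sequentially by blast
    obtain \<gamma> where \<gamma>: "\<And>n. causal_curve_from_to l (x n) (y n) 0 1 (\<gamma> n)"
      "\<And>n. L_ell l 0 1 (\<gamma> n) = l (x n) (y n)"
      using chron_imp_maximal_curve(2)[OF ms gh lls chron] by metis
    have len: "c \<le> - L_ell l 0 1 (\<gamma> n)" for n
      using xy[of n] chron[of n] by (simp add: \<gamma>(2) ell_minus_causal chron_imp_causal_le)
    have sub: "\<gamma> (n + N) ` {0..1} \<subseteq> K" for n
      using N[of "n + N"] \<gamma>(1) by simp
    \<comment> \<open>The constant sequence \<open>c\<close> serves as the lower bound for the
      lengths.\<close>
    have "\<exists>\<sigma> C. causal_path l {0..1} \<sigma> \<and> C-lipschitz_on {0..1} \<sigma> \<and>
        \<sigma> 0 = p \<and> \<sigma> 1 = q \<and> c \<le> - L_ell l 0 1 \<sigma>"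
      using limit_length[where x = "\<lambda>n. x (n + N)" and y = "\<lambda>n. y (n + N)" and a = "\<lambda>_. 0"
          and b = "\<lambda>_. 1" and \<gamma> = "\<lambda>n. \<gamma> (n + N)",
          OF ms nti spaces(3,2) K(1) \<gamma>(1) sub LIMSEQ_ignore_initial_segment[OF lim(1)]
            LIMSEQ_ignore_initial_segment[OF lim(2)] len tendsto_const] by blast
    then obtain \<sigma> where \<sigma>: "causal_path l {0..1} \<sigma>" "\<sigma> 0 = p" "\<sigma> 1 = q" "c \<le> - L_ell l 0 1 \<sigma>"
      by blast
    have "l p q \<le> L_ell l 0 1 \<sigma>"
      using le_path_length[of 0 1 l \<sigma>] \<sigma>(2,3) by simp
    then have "- L_ell l 0 1 \<sigma> \<le> ell_minus l p q"
      unfolding ell_minus_def by (simp add: le_max_iff_disj)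
    with \<sigma>(4) have "c \<le> ell_minus l p q" by (rule order_trans)
    then show "pq \<in> {(x, y). c \<le> ell_minus l x y}" by (simp add: p_def q_def case_prod_unfold)
  qed
qed

section \<open>Continuity from two semicontinuities, and the pairs with infinite separation\<close>

lemma continuous_on_UNIV_semicontinuous:
  fixes f :: "'b::topological_space \<Rightarrow> ereal"
  assumes "lower_semicontinuous f" "\<And>c. closed {p. c \<le> f p}"
  shows "continuous_on UNIV f"
proof -
  have "(f \<longlongrightarrow> f p) (at p)" for p
  proof (rule order_tendstoI)
    fix c assume "c < f p"
    then have "eventually (\<lambda>p. p \<in> {p. c < f p}) (nhds p)"
      using assms(1) by (intro eventually_nhds_in_open) (auto simp: lower_semicontinuous_def)
    then show "eventually (\<lambda>p. c < f p) (at p)"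
      by (auto simp: eventually_at_filter elim: eventually_mono)
  next
    fix c assume "f p < c"
    moreover have "open (- {p. c \<le> f p})" using assms(2) by (rule open_Compl)
    ultimately have "eventually (\<lambda>p. p \<in> - {p. c \<le> f p}) (nhds p)"
      by (intro eventually_nhds_in_open) auto
    then show "eventually (\<lambda>p. f p < c) (at p)"
      by (auto simp: eventually_at_filter elim: eventually_mono)
  qed
  then show ?thesis by (simp add: continuous_on_def)
qed

lemma infinite_iff_not_causal: "metric_spacetime l \<Longrightarrow> l x y = \<infinity> \<longleftrightarrow> \<not> causal_le l x y"
  unfolding metric_spacetime_def causal_le_def by (metis ereal_infty_less_eq(1) infinity_ereal_def
      zero_ereal_def ereal.distinct(1))

section \<open>Localizing neighbourhoods from geodesics\<close>

text \<open>Every curve length lies between 0 and \<open>ell_minus\<close>. An \<ell>-curve attains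
  the upper end for chronologically related points; for all others both ends are 0, which is also
  the default in the absence of curves.\<close>

lemma curve_separation_eq_ell_minus:
  assumes ms: "metric_spacetime l" and ccc: "causally_curve_connected l"
    and geo: "chron_geodesic_space l" and refl: "\<And>x. l x x = 0"
  shows "curve_separation l x y = ell_minus l x y"
proof -
  let ?S = "{- L_ell l a b \<sigma> | a b \<sigma>. causal_curve_from_to l x y a b \<sigma>}"
  have bounds: "0 \<le> v \<and> v \<le> ell_minus l x y" if "v \<in> ?S" for v
  proof -
    from that obtain a b \<sigma> where v: "v = - L_ell l a b \<sigma>" and \<sigma>: "causal_curve_from_to l x y a b \<sigma>"
      by blast
    from causal_curve_L_ell_bounds[OF \<sigma>] show ?thesis
      unfolding v ell_minus_def by (simp add: le_max_iff_disj ereal_0_le_uminus_iff)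
  qed
  show ?thesis
  proof (cases "chron l x y")
    case True
    then obtain \<sigma> where \<sigma>: "ell_curve l \<sigma>" "\<sigma> 0 = x" "\<sigma> 1 = y"
      using geo unfolding chron_geodesic_space_def by blast
    then have curve: "causal_curve_from_to l x y 0 1 \<sigma>"
      by (simp add: ell_curve_def causal_curve_from_to_def)
    moreover have "- L_ell l 0 1 \<sigma> = ell_minus l x y"
      using \<sigma> True by (simp add: ell_curve_def ell_minus_causal chron_imp_causal_le)
    ultimately have "ell_minus l x y \<in> ?S" by (metis (mono_tags, lifting) mem_Collect_eq)
    then have "Sup ?S = ell_minus l x y"
      using bounds by (intro Sup_eqI) auto
    then show ?thesis using curve by (auto simp: curve_separation_def)
  next
    case False
    then have zero: "ell_minus l x y = 0"
      using ell_minus_pos_iff[of l x y] ell_minus_nonneg[of l x y] by auto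
    show ?thesis
    proof (cases "\<exists>a b \<sigma>. causal_curve_from_to l x y a b \<sigma>")
      case True
      then obtain v where v: "v \<in> ?S" by blast
      have "0 \<le> Sup ?S" using bounds[OF v] Sup_upper2[OF v, of 0] by blast
      moreover have "Sup ?S \<le> 0" using bounds unfolding zero by (intro Sup_least) blast
      ultimately have "Sup ?S = 0" by (rule antisym[rotated])
      with True zero show ?thesis by (simp add: curve_separation_def)
    qed (auto simp: curve_separation_def zero)
  qed
qed

lemma causally_curve_connectedI:
  fixes l :: "'a::metric_space \<Rightarrow> 'a \<Rightarrow> ereal"
  assumes ms: "metric_spacetime l" and gh: "globally_hyperbolic l"
    and lcc: "locally_causally_closed l"
    and tcc: "timelike_curve_connected l" and geo: "chron_geodesic_space l"
    and fut: "\<And>x. chron_future l x \<noteq> {}"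
  shows "causally_curve_connected l"
  unfolding causally_curve_connected_def
proof (intro allI impI, elim conjE)
  fix x y :: 'a assume xy: "causal_le l x y" "x \<noteq> y"
  obtain z where "chron l y z" using fut[of y] by (auto simp: chron_future_def)
  then obtain a b \<beta> where \<beta>: "timelike_curve l {a..b} \<beta>" "\<beta> a = y" "\<beta> b = z"
    using tcc unfolding timelike_curve_connected_def by metis
  have causal: "causal_curve l {a..b} \<beta>" and timelike: "timelike_path l {a..b} \<beta>"
    using \<beta>(1) by (simp_all add: timelike_curve_def)
  have ab: "a < b" using causal by (rule causal_curve_less)
  \<comment> \<open>Parameters decreasing from \<open>t 0 = b\<close> to \<open>a\<close>, never
    reaching \<open>a\<close>, so that each \<open>\<beta> (t n)\<close> lies strictly in the
    chronological future of \<open>y\<close>.\<close>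
  define t where "t n = a + (b - a) * inverse (real (Suc n))" for n
  have t: "a < t n" "t n \<le> b" for n
  proof -
    have "inverse (real (Suc n)) \<le> 1" by (simp add: inverse_le_1_iff)
    then have "(b - a) * inverse (real (Suc n)) \<le> (b - a) * 1"
      using ab by (intro mult_left_mono) auto
    moreover have "0 < (b - a) * inverse (real (Suc n))" using ab by simp
    ultimately show "a < t n" "t n \<le> b" unfolding t_def mult_1_right by linarith+
  qed
  have "t \<longlonglongrightarrow> a + (b - a) * 0"
    unfolding t_def by (intro tendsto_intros LIMSEQ_inverse_real_of_nat)
  moreover obtain k where "k-lipschitz_on {a..b} \<beta>"
    using locally_lipschitz_on_interval_imp_lipschitz[of a b \<beta>] causal ab
    unfolding causal_curve_def by auto
  then have "continuous_on {a..b} \<beta>" by (rule lipschitz_on_continuous_on)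
  ultimately have "(\<lambda>n. \<beta> (t n)) \<longlonglongrightarrow> \<beta> a"
    using continuous_on_tendsto_compose[of "{a..b}" \<beta> t a sequentially] t ab
    by (auto simp: less_imp_le)
  then have lim: "(\<lambda>n. \<beta> (t n)) \<longlonglongrightarrow> y" by (simp add: \<beta>(2))
  \<comment> \<open>If \<open>x\<close> and \<open>y\<close> are only null related, geodesy gives no
    curve to \<open>y\<close> itself; from \<open>x\<close> to the later points
    \<open>\<beta> (t n)\<close> it does.\<close>
  have "chron l x (\<beta> (t n))" for n
  proof -
    have "chron l y (\<beta> (t n))"
      using timelike t[of n] ab \<beta>(2) by (auto simp: timelike_path_def chron_def)
    with ms xy(1) show ?thesis by (rule causal_le_chron_trans)
  qed
  then have "\<exists>\<gamma>. ell_curve l \<gamma> \<and> \<gamma> 0 = x \<and> \<gamma> 1 = \<beta> (t n)" for n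
    using geo unfolding chron_geodesic_space_def by blast
  then obtain \<gamma> where \<gamma>: "\<And>n. ell_curve l (\<gamma> n)" "\<And>n. \<gamma> n 0 = x" "\<And>n. \<gamma> n 1 = \<beta> (t n)"
    by metis
  have from_to: "causal_curve_from_to l x (\<beta> (t n)) 0 1 (\<gamma> n)" for n
    using \<gamma>[of n] by (simp add: ell_curve_def causal_curve_from_to_def)
  have "causal_le l (\<beta> (t n)) z" for n
    using causal_pathD[OF ms, of a b \<beta> "t n" b] causal t[of n] \<beta>(3)
    by (simp add: causal_curve_def)
  then have sub: "\<gamma> n ` {0..1} \<subseteq> causal_diamond l x z" for n
    using metric_spacetime_refl[OF ms, of x]
    by (intro causal_curve_diamond[OF ms from_to]) (auto simp: causal_le_def)
  have nti: "non_totally_imprisoning l" and K: "compact (causal_diamond l x z)"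
    using gh by (simp_all add: globally_hyperbolic_def)
  obtain C \<sigma> where "causal_path l {0..1} \<sigma>" "C-lipschitz_on {0..1} \<sigma>" "\<sigma> 0 = x" "\<sigma> 1 = y"
    by (rule limit_curve[where x = "\<lambda>_. x" and y = "\<lambda>n. \<beta> (t n)" and a = "\<lambda>_. 0"
          and b = "\<lambda>_. 1" and \<gamma> = \<gamma>, OF ms nti lcc K from_to sub tendsto_const lim])
      (rule that)
  then have "causal_curve_from_to l x y 0 1 \<sigma>"
    using xy(2) by (intro causal_curve_from_toI) auto
  then show "\<exists>a b \<sigma>. causal_curve_from_to l x y a b \<sigma>" by blast
qed

text \<open>The neighbourhood \<Omega> is causally convex, so curves that maximize globally between
  two of its points stay inside, and the global separation serves as the local one.\<close>

lemma localizableI: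
  fixes l :: "'a::metric_space \<Rightarrow> 'a \<Rightarrow> ereal"
  assumes ms: "metric_spacetime l" and gh: "globally_hyperbolic l"
    and pre: "lorentzian_prelength_space l" and ccc: "causally_curve_connected l"
    and tcc: "timelike_curve_connected l" and geo: "chron_geodesic_space l"
    and nonempty: "\<And>x. chron_future l x \<noteq> {}" "\<And>x. chron_past l x \<noteq> {}"
    and cont: "continuous_on UNIV (\<lambda>(x, y). ell_minus l x y)"
    and fin: "\<And>x y. \<bar>ell_minus l x y\<bar> \<noteq> \<infinity>"
  shows "localizable l"
  unfolding localizable_def
proof
  fix x
  obtain y z where yz: "chron l y x" "chron l x z"
    using nonempty[of x] by (auto simp: chron_future_def chron_past_def)
  define \<Omega> where "\<Omega> = chron_future l y \<inter> chron_past l z"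
  define \<omega> where "\<omega> p r = real_of_ereal (ell_minus l p r)" for p r
  have \<omega>: "ereal (\<omega> p r) = ell_minus l p r" for p r
    using fin[of p r] by (simp add: \<omega>_def ereal_real)
  have \<Omega>_iff: "p \<in> \<Omega> \<longleftrightarrow> chron l y p \<and> chron l p z" for p
    by (simp add: \<Omega>_def chron_future_def chron_past_def)
  have "open \<Omega>" unfolding \<Omega>_def by (intro open_Int prelength_open_chron[OF pre])
  moreover have "x \<in> \<Omega>" using yz by (simp add: \<Omega>_iff)
  moreover have "curve_length_bounded l \<Omega>"
  proof -
    have sub: "\<Omega> \<subseteq> causal_diamond l y z"
      by (auto simp: \<Omega>_iff causal_diamond_def chron_imp_causal_le)
    have "non_totally_imprisoning l" "compact (causal_diamond l y z)"
      using gh by (simp_all add: globally_hyperbolic_def)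
    then obtain C :: real where C: "\<forall>a b \<sigma>. causal_curve l {a..b} \<sigma> \<and>
        \<sigma> ` {a..b} \<subseteq> causal_diamond l y z \<longrightarrow> L_d a b \<sigma> \<le> ereal C"
      unfolding non_totally_imprisoning_def by blast
    \<comment> \<open>The maximum with 1 provides the strict positivity demanded of the
      bound.\<close>
    have "L_d a b \<sigma> \<le> ereal (max C 1)"
      if "causal_curve l {a..b} \<sigma>" "\<sigma> ` {a..b} \<subseteq> \<Omega>" for a b \<sigma>
    proof -
      have "L_d a b \<sigma> \<le> ereal C" using C that(1) order_trans[OF that(2) sub] by simp
      also have "\<dots> \<le> ereal (max C 1)" by simp
      finally show ?thesis .
    qed
    then show ?thesis
      unfolding curve_length_bounded_def by (intro exI[of _ "max C 1"]) auto
  qed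
  moreover have "local_time_separation l \<Omega> \<omega>"
    unfolding local_time_separation_def
  proof (intro conjI ballI impI)
    have "(\<lambda>(p, r). \<omega> p r) = (\<lambda>u. real_of_ereal (case u of (p, r) \<Rightarrow> ell_minus l p r))"
      by (auto simp: \<omega>_def)
    \<comment> \<open>Conversion from \<open>ereal\<close> to \<open>real\<close> preserves limits
      here because the limit values are finite.\<close>
    moreover have "continuous_on UNIV (\<lambda>u. real_of_ereal (case u of (p, r) \<Rightarrow> ell_minus l p r))"
      unfolding continuous_on_def
    proof
      fix u :: "'a \<times> 'a"
      have "((\<lambda>(p, r). ell_minus l p r) \<longlongrightarrow> ereal (\<omega> (fst u) (snd u))) (at u)"
        using cont unfolding \<omega> by (cases u) (simp add: continuous_on_def case_prod_unfold)
      from lim_real_of_ereal[OF this]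
      show "((\<lambda>u. real_of_ereal (case u of (p, r) \<Rightarrow> ell_minus l p r)) \<longlongrightarrow>
          real_of_ereal (case u of (p, r) \<Rightarrow> ell_minus l p r)) (at u within UNIV)"
        by (simp add: \<omega>_def case_prod_unfold)
    qed
    ultimately show "continuous_on (\<Omega> \<times> \<Omega>) (\<lambda>(p, r). \<omega> p r)"
      by (auto intro: continuous_on_subset)
  next
    fix p r show "0 \<le> \<omega> p r"
      using ell_minus_nonneg[of l p r] by (simp flip: \<omega>)
  next
    fix p s r assume "causal_le l p s \<and> causal_le l s r"
    then show "\<omega> p s + \<omega> s r \<le> \<omega> p r"
      using ell_minus_triangle[OF ms, of p s r] by (simp flip: \<omega>)
  next
    fix p r assume "\<not> causal_le l p r"
    then have "\<not> chron l p r" using chron_imp_causal_le[of l p r] by blast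
    then have "ell_minus l p r = 0"
      using ell_minus_pos_iff[of l p r] ell_minus_nonneg[of l p r] by auto
    then show "\<omega> p r = 0" by (simp add: \<omega>_def)
  next
    fix p r show "0 < \<omega> p r \<longleftrightarrow> chron l p r"
      using ell_minus_pos_iff[of l p r] by (simp flip: \<omega>)
  next
    \<comment> \<open>The midpoint of a timelike curve. Between \<open>p\<close> and
      \<open>z\<close>, and between \<open>y\<close> and \<open>p\<close>, it gives points of
      \<Omega> on either side of \<open>p\<close>.\<close>
    have between: "\<exists>v. chron l p v \<and> chron l v r" if pr: "chron l p r" for p r
    proof -
      obtain a b \<beta> where \<beta>: "timelike_curve l {a..b} \<beta>" "\<beta> a = p" "\<beta> b = r"
        using tcc pr unfolding timelike_curve_connected_def by metis
      then have "a < b" using causal_curve_less[of l a b \<beta>] by (simp add: timelike_curve_def)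
      with \<beta> have "chron l p (\<beta> ((a + b) / 2)) \<and> chron l (\<beta> ((a + b) / 2)) r"
        unfolding timelike_curve_def timelike_path_def chron_def by auto
      then show ?thesis by blast
    qed
    fix p assume p: "p \<in> \<Omega>"
    then obtain v w where v: "chron l p v" "chron l v z" and w: "chron l y w" "chron l w p"
      using between[of p z] between[of y p] by (auto simp: \<Omega>_iff)
    have "v \<in> \<Omega>"
      using p v chron_causal_le_trans[OF ms, of y p v] by (simp add: \<Omega>_iff chron_imp_causal_le)
    then show "chron_future l p \<inter> \<Omega> \<noteq> {}" using v(1) by (auto simp: chron_future_def)
    have "w \<in> \<Omega>"
      using p w chron_causal_le_trans[OF ms, of w p z] by (simp add: \<Omega>_iff chron_imp_causal_le)
    then show "chron_past l p \<inter> \<Omega> \<noteq> {}" using w(2) by (auto simp: chron_past_def)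
  qed
  moreover have "locally_maximizing l \<Omega> \<omega>"
    unfolding locally_maximizing_def
  proof (intro ballI impI)
    fix p r assume pr: "p \<in> \<Omega>" "r \<in> \<Omega>" "causal_less l p r"
    have le: "causal_le l p r" "p \<noteq> r" using pr(3) by (simp_all add: causal_less_def)
    have "\<exists>a b \<sigma>. causal_curve_from_to l p r a b \<sigma> \<and> L_ell l a b \<sigma> = l p r"
    proof (cases "chron l p r")
      case True
      then obtain \<gamma> where "ell_curve l \<gamma>" "\<gamma> 0 = p" "\<gamma> 1 = r"
        using geo unfolding chron_geodesic_space_def by blast
      then have "causal_curve_from_to l p r 0 1 \<gamma> \<and> L_ell l 0 1 \<gamma> = l p r"
        by (simp add: ell_curve_def causal_curve_from_to_def)
      then show ?thesis by blast
    next
      \<comment> \<open>For null related points every causal curve is maximal: its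
        \<open>L_ell\<close> lies between \<open>l p r = 0\<close> and 0.\<close>
      case False
      with le(1) have "l p r = 0" by (simp add: chron_def causal_le_def)
      moreover obtain a b \<sigma> where "causal_curve_from_to l p r a b \<sigma>"
        using ccc le unfolding causally_curve_connected_def by blast
      moreover from this have "L_ell l a b \<sigma> = 0"
        using causal_curve_L_ell_bounds[of l p r a b \<sigma>] \<open>l p r = 0\<close> by simp
      ultimately show ?thesis by auto
    qed
    then obtain a b \<sigma> where \<sigma>: "causal_curve_from_to l p r a b \<sigma>" "L_ell l a b \<sigma> = l p r"
      by blast
    have "\<sigma> ` {a..b} \<subseteq> causal_diamond l p r"
      using metric_spacetime_refl[OF ms]
      by (intro causal_curve_diamond[OF ms \<sigma>(1)]) (simp_all add: causal_le_def)
    \<comment> \<open>Causal convexity: anything between \<open>p\<close> and \<open>r\<close> is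
      after \<open>y\<close> and before \<open>z\<close>.\<close>
    also have "causal_diamond l p r \<subseteq> \<Omega>"
      using pr(1,2) chron_causal_le_trans[OF ms, of y p] causal_le_chron_trans[OF ms, of _ r z]
      by (auto simp: causal_diamond_def \<Omega>_iff)
    finally have sub: "\<sigma> ` {a..b} \<subseteq> \<Omega>" .
    have "- L_ell l a b \<sigma> = ereal (\<omega> p r)"
      using le(1) by (simp add: \<sigma>(2) \<omega> ell_minus_causal)
    moreover have "L_ell l a b \<sigma> \<le> L_ell l a' b' \<sigma>'"
      if "causal_curve_from_to l p r a' b' \<sigma>'" for a' b' \<sigma>'
      using causal_curve_L_ell_bounds(1)[OF that] by (simp add: \<sigma>(2))
    ultimately show "\<exists>a b \<sigma>. causal_curve_from_to l p r a b \<sigma> \<and> \<sigma> ` {a..b} \<subseteq> \<Omega> \<and>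
        (\<forall>a' b' \<sigma>'. causal_curve_from_to l p r a' b' \<sigma>' \<and> \<sigma>' ` {a'..b'} \<subseteq> \<Omega> \<longrightarrow>
          L_ell l a b \<sigma> \<le> L_ell l a' b' \<sigma>') \<and>
        - L_ell l a b \<sigma> = ereal (\<omega> p r) \<and> ereal (\<omega> p r) \<le> ell_minus l p r"
      using \<sigma>(1) sub \<omega>[of p r] by (intro exI[of _ a] exI[of _ b] exI[of _ \<sigma>]) auto
  qed
  ultimately show "\<exists>\<Omega>. open \<Omega> \<and> x \<in> \<Omega> \<and> curve_length_bounded l \<Omega> \<and>
      (\<exists>\<omega>. local_time_separation l \<Omega> \<omega> \<and> locally_maximizing l \<Omega> \<omega>)"
    by blast
qed

section \<open>The two implications of the equivalence\<close>

theorem lemma10: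
  fixes l :: "'a::metric_space \<Rightarrow> 'a \<Rightarrow> ereal"
  assumes "metric_spacetime l"
    and "globally_hyperbolic l"
  shows "lorentzian_length_space l \<longleftrightarrow>
    timelike_curve_connected l \<and>
    chron_geodesic_space l \<and>
    (\<forall>x. chron_future l x \<noteq> {} \<and> chron_past l x \<noteq> {}) \<and>
    open {(x, y). l x y = \<infinity>} \<and>
    (continuous_on UNIV (\<lambda>(x, y). ell_minus l x y) \<and> (\<forall>x y. \<bar>ell_minus l x y\<bar> \<noteq> \<infinity>))"
  (is "_ \<longleftrightarrow> ?R")
proof
  \<comment> \<open>A time separation is either nonpositive or infinite, so openness of the infinite
    set is closedness of the causal relation.\<close>
  have noncausal: "{(x, y). l x y = \<infinity>} = - {(x, y). causal_le l x y}"
    using infinite_iff_not_causal[OF assms(1)] by auto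
  show ?R if lls: "lorentzian_length_space l"
  proof (intro conjI allI)
    have spaces: "lorentzian_prelength_space l" "localizable l"
      using lls by (simp_all add: lorentzian_length_space_def)
    show "timelike_curve_connected l" using lls by (simp add: lorentzian_length_space_def)
    show "chron_geodesic_space l"
      unfolding chron_geodesic_space_def
    proof (intro conjI allI impI)
      fix x y assume "chron l x y"
      from chron_imp_maximal_curve(2)[OF assms lls this]
      show "\<exists>\<sigma>. ell_curve l \<sigma> \<and> \<sigma> 0 = x \<and> \<sigma> 1 = y"
        unfolding ell_curve_def causal_curve_from_to_def by blast
    qed (rule assms(1))
    fix x
    show "chron_future l x \<noteq> {}" "chron_past l x \<noteq> {}"
      using localizable_chron_nonempty[OF spaces(2)] by auto
    show "open {(x, y). l x y = \<infinity>}"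
      unfolding noncausal using globally_hyperbolic_causal_le_closed[OF assms lls] by (rule open_Compl)
    show "continuous_on UNIV (\<lambda>(x, y). ell_minus l x y)"
      using spaces(1) ell_minus_upper_level_closed[OF assms lls]
      by (intro continuous_on_UNIV_semicontinuous)
        (simp_all add: lorentzian_prelength_space_def case_prod_unfold)
    fix y
    \<comment> \<open>For chronologically related points finiteness comes from the maximal curve;
      elsewhere \<open>ell_minus\<close> is 0.\<close>
    show "\<bar>ell_minus l x y\<bar> \<noteq> \<infinity>"
      using chron_imp_maximal_curve(1)[OF assms lls, of x y] ell_minus_pos_iff[of l x y]
        ell_minus_nonneg[of l x y] by (cases "chron l x y") (auto simp: less_le)
  qed
  show "lorentzian_length_space l" if R: ?R
  proof -
    have tcc: "timelike_curve_connected l" and geo: "chron_geodesic_space l"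
      and nonempty: "\<And>x. chron_future l x \<noteq> {}" "\<And>x. chron_past l x \<noteq> {}"
      and cont: "continuous_on UNIV (\<lambda>(x, y). ell_minus l x y)"
      and fin: "\<And>x y. \<bar>ell_minus l x y\<bar> \<noteq> \<infinity>"
      using R by auto
    have pre: "lorentzian_prelength_space l"
      unfolding lorentzian_prelength_space_def lower_semicontinuous_def
      using assms(1) cont by (auto intro: open_Collect_less)
    have "closed {(x, y). causal_le l x y}"
      using R unfolding noncausal by (simp add: closed_def)
    \<comment> \<open>The relation is closed globally, so the whole space serves as the
      neighbourhood of every point.\<close>
    then have lcc: "locally_causally_closed l"
      unfolding locally_causally_closed_def by (intro allI exI[of _ UNIV]) simp
    have ccc: "causally_curve_connected l"
      using causally_curve_connectedI[OF assms lcc tcc geo nonempty(1)] .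
    have "localizable l"
      using localizableI[OF assms pre ccc tcc geo nonempty cont fin] .
    moreover from this have "\<And>x. l x x = 0" by (rule localizable_imp_l_refl[OF assms(1)])
    ultimately show ?thesis
      using pre lcc ccc tcc curve_separation_eq_ell_minus[OF assms(1) ccc geo]
      by (simp add: lorentzian_length_space_def)
  qed
qed

end
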